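(* Let $X$ be a nonempty set, $\Sigma$ a lattice of subsets of $X$, $E$ an ordered Banach space, $\boldsymbol{\mu}:\Sigma\rightarrow E_{+}$ a vector capacity and $A\in\Sigma$. (a) If $f$ and $g$ are Choquet-Bochner integrable functions, then: - (positivity) $f\geq0$ implies $(\mathrm{CB})\int_{A}f\,\mathrm{d}\boldsymbol{\mu}\geq0$; - (monotonicity) $f\leq g$ implies $(\mathrm{CB})\int_{A}f\,\mathrm{d}\boldsymbol{\mu}\leq(\mathrm{CB})\int_{A}g\,\mathrm{d}\boldsymbol{\mu}$; - (positive homogeneity) $(\mathrm{CB})\int_{A}af\,\mathrm{d}\boldsymbol{\mu}=a\cdot(\mathrm{CB})\int_{A}f\,\mathrm{d}\boldsymbol{\mu}$ for all $a\geq0$; - (calibration) $(\mathrm{CB})\int_{A}1\,\mathrm{d}\boldsymbol{\mu}=\boldsymbol{\mu}(A)$. (b) If $f$ and $g$ are Choquet-Bochner integrable functions that are comonotonic, that is, $(f(\omega)-f(\omega'))\cdot(g(\omega)-g(\omega'))\geq0$ for all $\omega,\omega'\in X$, then $$(\mathrm{CB})\int_{A}(f+g)\,\mathrm{d}\boldsymbol{\mu}=(\mathrm{CB})\int_{A}f\,\mathrm{d}\boldsymbol{\mu}+(\mathrm{CB})\int_{A}g\,\mathrm{d}\boldsymbol{\mu}.$$ In particular, the Choquet-Bochner integral is translation invariant: $$(\mathrm{CB})\int_{A}(f+c)\,\mathrm{d}\boldsymbol{\mu}=(\mathrm{CB})\int_{A}f\,\mathrm{d}\boldsymbol{\mu}+c\,\boldsymbol{\mu}(A)$$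 for all Choquet-Bochner integrable functions $f$, all sets $A\in\Sigma$ and all numbers $c\in\mathbb{R}$.
   Context: An ordered Banach space is a real Banach space $E$ with a compatible vector order whose positive cone $E_{+}=\{x\in E:x\geq0\}$ is norm-closed, proper ($E_+\cap(-E_+)=\{0\}$) and generating ($E=E_{+}-E_{+}$), and such that $0\leq x\leq y$ implies $\Vert x\Vert\leq\Vert y\Vert$. A lattice of subsets of $X$ is a collection $\Sigma$ of subsets containing $\emptyset$ and $X$ and closed under finite unions and intersections. A vector capacity is a set function $\boldsymbol{\mu}:\Sigma\to E_+$ with $\boldsymbol{\mu}(\emptyset)=0$ and $\boldsymbol{\mu}(A)\leq\boldsymbol{\mu}(B)$ whenever $A\subset B$ in $\Sigma$. A function $f:X\to\mathbb{R}$ is measurable if $\{x\in X:f(x)\geq t\}\in\Sigma$ for all $t\in\mathbb{R}$. A measurable $f$ is Choquet-Bochner integrable (with respect to $\boldsymbol{\mu}$) if for every $A\in\Sigma$ the functions $t\mapsto\boldsymbol{\mu}(\{x\in A:f(x)\geq t\})$ and $t\mapsto\boldsymbol{\mu}(\{x\in A:f(x)\geq t\})-\boldsymbol{\mu}(A)$ are Bochner integrable (Lebesgue measure) on $[0,\infty)$ and $(-\infty,0]$ respectively. Under these circumstances its Choquet-Bochner integral over $A$ is defined as $$(\mathrm{CB})\int_{A}f\,\mathrm{d}\boldsymbol{\mu}=\int_{0}^{+\infty}\boldsymbol{\mu}(\{x\in A:f(x)\geq t\})\,\mathrm{d}t+\int_{-\infty}^{0}\left[\boldsymbol{\mu}(\{x\in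 A:f(x)\geq t\})-\boldsymbol{\mu}(A)\right]\mathrm{d}t .$$ *)

theory Defs
  imports "HOL-Analysis.Analysis"
begin

text \<open>
  The positive cone is proper because the order of \<^class>\<open>ordered_real_vector\<close> is antisymmetric.
\<close>

class ordered_banach = banach + ordered_real_vector +
  assumes closed_cone: "closed {x. 0 \<le> x}"
    and generating_cone: "\<exists>y z. 0 \<le> y \<and> 0 \<le> z \<and> x = y - z"
    and norm_mono_cone: "0 \<le> x \<Longrightarrow> x \<le> y \<Longrightarrow> norm x \<le> norm y"

text \<open>
  The library's \<^const>\<open>has_bochner_integral\<close> is available only for second countable, that is,
  separable, target spaces. The predicates below extend it to arbitrary normed targets by
  replacing Borel measurability with strong measurability (almost everywhere the limit
  of simple functions).
\<close>

definition strongly_measurable :: "'a measure \<Rightarrow> ('a \<Rightarrow> 'b::real_normed_vector) \<Rightarrow> bool" where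
  "strongly_measurable M f \<longleftrightarrow>
     (\<exists>s. (\<forall>i. simple_function M (s i)) \<and> (AE x in M. (\<lambda>i::nat. s i x) \<longlonglongrightarrow> f x))"

definition has_bochner :: "'a measure \<Rightarrow> ('a \<Rightarrow> 'b::real_normed_vector) \<Rightarrow> 'b \<Rightarrow> bool" where
  "has_bochner M f I \<longleftrightarrow> strongly_measurable M f \<and>
     (\<exists>s. (\<forall>i. Bochner_Integration.simple_bochner_integrable M (s i)) \<and>
          (\<lambda>i::nat. \<integral>\<^sup>+x. norm (f x - s i x) \<partial>M) \<longlonglongrightarrow> 0 \<and>
          (\<lambda>i. Bochner_Integration.simple_bochner_integral M (s i)) \<longlonglongrightarrow> I)"

definition bochner_integrable :: "'a measure \<Rightarrow> ('a \<Rightarrow> 'b::real_normed_vector) \<Rightarrow> bool" where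
  "bochner_integrable M f \<longleftrightarrow> (\<exists>I. has_bochner M f I)"

definition bochner_integral :: "'a measure \<Rightarrow> ('a \<Rightarrow> 'b::real_normed_vector) \<Rightarrow> 'b" where
  "bochner_integral M f = (if bochner_integrable M f then THE I. has_bochner M f I else 0)"

lemma has_bochner_integral_imp_has_bochner:
  fixes f :: "'a \<Rightarrow> 'b::{real_normed_vector, second_countable_topology}"
  assumes "has_bochner_integral M f I"
  shows "has_bochner M f I"
proof -
  from assms obtain s where f: "f \<in> borel_measurable M"
    and s: "\<And>i. Bochner_Integration.simple_bochner_integrable M (s i)"
      "(\<lambda>i. \<integral>\<^sup>+x. norm (f x - s i x) \<partial>M) \<longlonglongrightarrow> 0"
      "(\<lambda>i. Bochner_Integration.simple_bochner_integral M (s i)) \<longlonglongrightarrow> I"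
    by (rule has_bochner_integral.cases) (rule that)
  from borel_measurable_implies_sequence_metric[OF f, of 0]
  have "strongly_measurable M f"
    unfolding strongly_measurable_def by (blast intro: AE_I2)
  with s show ?thesis
    unfolding has_bochner_def by blast
qed

definition lattice_of_sets :: "'x set \<Rightarrow> 'x set set \<Rightarrow> bool" where
  "lattice_of_sets X S \<longleftrightarrow> S \<subseteq> Pow X \<and> {} \<in> S \<and> X \<in> S \<and>
     (\<forall>A\<in>S. \<forall>B\<in>S. A \<union> B \<in> S \<and> A \<inter> B \<in> S)"

definition vector_capacity :: "'x set set \<Rightarrow> ('x set \<Rightarrow> 'e::ordered_banach) \<Rightarrow> bool" where
  "vector_capacity S \<mu> \<longleftrightarrow> (\<forall>A\<in>S. 0 \<le> \<mu> A) \<and> \<mu> {} = 0 \<and>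
     (\<forall>A\<in>S. \<forall>B\<in>S. A \<subseteq> B \<longrightarrow> \<mu> A \<le> \<mu> B)"

definition level_measurable :: "'x set \<Rightarrow> 'x set set \<Rightarrow> ('x \<Rightarrow> real) \<Rightarrow> bool" where
  "level_measurable X S f \<longleftrightarrow> (\<forall>t. {x \<in> X. f x \<ge> t} \<in> S)"

definition cb_integrable ::
    "'x set \<Rightarrow> 'x set set \<Rightarrow> ('x set \<Rightarrow> 'e::ordered_banach) \<Rightarrow> ('x \<Rightarrow> real) \<Rightarrow> bool" where
  "cb_integrable X S \<mu> f \<longleftrightarrow> level_measurable X S f \<and>
     (\<forall>A\<in>S. bochner_integrable (lebesgue_on {0..}) (\<lambda>t. \<mu> {x \<in> A. f x \<ge> t}) \<and>
            bochner_integrable (lebesgue_on {..0}) (\<lambda>t. \<mu> {x \<in> A. f x \<ge> t} - \<mu> A))"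

definition cb_integral ::
    "('x set \<Rightarrow> 'e::ordered_banach) \<Rightarrow> 'x set \<Rightarrow> ('x \<Rightarrow> real) \<Rightarrow> 'e" where
  "cb_integral \<mu> A f =
     bochner_integral (lebesgue_on {0..}) (\<lambda>t. \<mu> {x \<in> A. f x \<ge> t}) +
     bochner_integral (lebesgue_on {..0}) (\<lambda>t. \<mu> {x \<in> A. f x \<ge> t} - \<mu> A)"

definition comonotonic :: "'x set \<Rightarrow> ('x \<Rightarrow> real) \<Rightarrow> ('x \<Rightarrow> real) \<Rightarrow> bool" where
  "comonotonic X f g \<longleftrightarrow> (\<forall>x\<in>X. \<forall>y\<in>X. (f x - f y) * (g x - g y) \<ge> 0)"

end

(* An integral of a decreasing function F with 0 <= F <= m is encoded by a primitive P, that is, by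
   (t - s) F(t) <= P(t) - P(s) <= (t - s) F(s) for s <= t; such P is unique up to a constant because
   upper and lower Riemann sums of mesh h differ by at most h (F(a) - F(b)). For F(t) = mu(A, f >= t),
   normalised so that P(t) - t mu(A) -> 0 at -infinity, P tends to the Choquet-Bochner integral at
   +infinity. Comonotonic f, g are monotone functions u, v of h = f + g with u + v = id, so that
   P_f(u(t)) + P_g(v(t)) is a primitive for h.

   Bochner integrability of h: a decreasing function with values in an ordered Banach space is
   strongly measurable iff it is norm continuous almost everywhere. The level function of h is
   continuous at t as soon as that of f is continuous at u(t) or that of g at v(t), and both fail only
   on a null set because u and v cannot both be flat. *)

theory Submission
  imports Defs "HOL-Real_Asymp.Real_Asymp"
begin

section \<open>Bochner integrals in Banach spaces that need not be separable\<close>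

text \<open>Monotonicity alone does not give Bochner integrability when E is not separable: the
  decreasing map that sends t in [0, 1] to the indicator of (t, 1], in the space of bounded
  functions on [0, 1], has values at mutual distance 1 and is not strongly measurable. Integrability
  of a sum must therefore be inherited from the summands. The obstacle is that u may pull null sets
  back to sets of positive measure, for instance where it is constant; only the pair (u, v) is
  harmless. Primitives take the place of a change of variables: their two inequalities survive
  substitution of a monotone u, with u(t) - u(s) as the length, and those for the two summands
  simply add. The level function of h need not be F(u(t)); it lies between the values of F strictly
  to the right of u(t) and F(u(t)), which is enough for both bounds. Two properties of the cone do
  the analytic work: closedness makes the order Archimedean, so that mesh errors disappear, and
  monotonicity of the norm turns order sandwiches into norm estimates.\<close>

lemma strongly_measurable_simple:
  "simple_function M s \<Longrightarrow> strongly_measurable M s"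
  unfolding strongly_measurable_def by (intro exI[of _ "\<lambda>_. s"]) auto

lemma strongly_measurable_add:
  assumes "strongly_measurable M f" "strongly_measurable M g"
  shows "strongly_measurable M (\<lambda>x. f x + g x)"
proof -
  obtain s where s: "\<And>i. simple_function M (s i)" "AE x in M. (\<lambda>i::nat. s i x) \<longlonglongrightarrow> f x"
    using assms(1) unfolding strongly_measurable_def by blast
  obtain r where r: "\<And>i. simple_function M (r i)" "AE x in M. (\<lambda>i::nat. r i x) \<longlonglongrightarrow> g x"
    using assms(2) unfolding strongly_measurable_def by blast
  have "AE x in M. (\<lambda>i. s i x + r i x) \<longlonglongrightarrow> f x + g x"
    using s(2) r(2) by eventually_elim (rule tendsto_add)
  moreover have "simple_function M (\<lambda>x. s i x + r i x)" for i
    by (rule simple_function_compose2[OF s(1) r(1)])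
  ultimately show ?thesis
    unfolding strongly_measurable_def by (intro exI[of _ "\<lambda>i x. s i x + r i x"]) auto
qed

lemma strongly_measurable_scaleR:
  fixes f :: "'a \<Rightarrow> 'b::real_normed_vector"
  assumes "strongly_measurable M f" and "simple_function M c"
  shows "strongly_measurable M (\<lambda>x. c x *\<^sub>R f x)"
proof -
  obtain s where s: "\<And>i. simple_function M (s i)" "AE x in M. (\<lambda>i::nat. s i x) \<longlonglongrightarrow> f x"
    using assms(1) unfolding strongly_measurable_def by blast
  have "AE x in M. (\<lambda>i. c x *\<^sub>R s i x) \<longlonglongrightarrow> c x *\<^sub>R f x"
    using s(2) by eventually_elim (intro tendsto_intros)
  moreover have "simple_function M (\<lambda>x. c x *\<^sub>R s i x)" for i
    by (rule simple_function_compose2[OF assms(2) s(1)])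
  ultimately show ?thesis
    unfolding strongly_measurable_def by (intro exI[of _ "\<lambda>i x. c x *\<^sub>R s i x"]) auto
qed

lemma strongly_measurable_diff:
  fixes f g :: "'a \<Rightarrow> 'b::real_normed_vector"
  assumes "strongly_measurable M f" "strongly_measurable M g"
  shows "strongly_measurable M (\<lambda>x. f x - g x)"
  using strongly_measurable_add[OF assms(1) strongly_measurable_scaleR[OF assms(2), of "\<lambda>_. -1"]]
  by simp

text \<open>The measure need not be complete, so a limit that exists only almost everywhere may have
  a nonmeasurable norm. Multiplying by the indicator of a measurable conull set yields convergence
  at every point and changes \<open>f\<close> on a null set only.\<close>

lemma strongly_measurable_pointwise:
  fixes f :: "'a \<Rightarrow> 'b::real_normed_vector"
  assumes "strongly_measurable M f"
  obtains f' s where "AE x in M. f x = f' x" "\<And>i. simple_function M (s i)"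
    "\<And>x. (\<lambda>i::nat. s i x) \<longlonglongrightarrow> f' x"
proof -
  obtain s where s: "\<And>i. simple_function M (s i)" "AE x in M. (\<lambda>i::nat. s i x) \<longlonglongrightarrow> f x"
    using assms unfolding strongly_measurable_def by blast
  obtain N where N: "{x\<in>space M. \<not> (\<lambda>i::nat. s i x) \<longlonglongrightarrow> f x} \<subseteq> N" "N \<in> null_sets M"
    using s(2) by (auto simp: eventually_ae_filter)
  let ?B = "space M - N"
  have B: "?B \<in> sets M" using N by auto
  show ?thesis
  proof
    show "AE x in M. f x = indicator ?B x *\<^sub>R f x"
      using AE_not_in[OF N(2)] AE_space by eventually_elim (auto simp: indicator_def)
    show "simple_function M (\<lambda>x. indicator ?B x *\<^sub>R s i x)" for i
      by (rule simple_function_compose2[OF simple_function_indicator[OF B] s(1)])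
    show "(\<lambda>i. indicator ?B x *\<^sub>R s i x) \<longlonglongrightarrow> indicator ?B x *\<^sub>R f x" for x
      using N(1) by (cases "x \<in> ?B") auto
  qed
qed

lemma strongly_measurable_norm:
  fixes f :: "'a \<Rightarrow> 'b::real_normed_vector"
  assumes "strongly_measurable M f"
  obtains \<phi> :: "'a \<Rightarrow> real" where "\<phi> \<in> borel_measurable M" "AE x in M. norm (f x) = \<phi> x"
proof -
  obtain f' s where f': "AE x in M. f x = f' x" "\<And>i. simple_function M (s i)"
    "\<And>x. (\<lambda>i::nat. s i x) \<longlonglongrightarrow> f' x"
    using strongly_measurable_pointwise[OF assms] by blast
  have "(\<lambda>x. norm (f' x)) \<in> borel_measurable M"
  proof (rule borel_measurable_LIMSEQ_metric)
    show "(\<lambda>x. norm (s i x)) \<in> borel_measurable M" for i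
      by (rule borel_measurable_simple_function, rule simple_function_compose1[OF f'(2)])
    show "(\<lambda>i. norm (s i x)) \<longlonglongrightarrow> norm (f' x)" for x
      by (intro tendsto_norm f')
  qed
  then show ?thesis
    using f'(1) by (intro that[of "\<lambda>x. norm (f' x)"]) auto
qed

text \<open>\<open>nn_integral\<close> is a supremum over simple functions below the integrand and
  is additive only for measurable integrands; hence the detour through measurable representatives of
  the two norms.\<close>

lemma nn_integral_norm_triangle:
  fixes f g :: "'a \<Rightarrow> 'b::real_normed_vector"
  assumes "strongly_measurable M f" "strongly_measurable M g"
  shows "(\<integral>\<^sup>+x. norm (f x + g x) \<partial>M) \<le> (\<integral>\<^sup>+x. norm (f x) \<partial>M) + (\<integral>\<^sup>+x. norm (g x) \<partial>M)"
proof -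
  obtain \<phi> :: "'a \<Rightarrow> real" where \<phi>[measurable]: "\<phi> \<in> borel_measurable M" and \<phi>_eq: "AE x in M. norm (f x) = \<phi> x"
    using strongly_measurable_norm[OF assms(1)] by blast
  obtain \<psi> :: "'a \<Rightarrow> real" where \<psi>[measurable]: "\<psi> \<in> borel_measurable M" and \<psi>_eq: "AE x in M. norm (g x) = \<psi> x"
    using strongly_measurable_norm[OF assms(2)] by blast
  have "(\<integral>\<^sup>+x. norm (f x + g x) \<partial>M) \<le> (\<integral>\<^sup>+x. ennreal (\<phi> x) + ennreal (\<psi> x) \<partial>M)"
  proof (rule nn_integral_mono_AE)
    show "AE x in M. ennreal (norm (f x + g x)) \<le> ennreal (\<phi> x) + ennreal (\<psi> x)"
      using \<phi>_eq \<psi>_eq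
    proof eventually_elim
      case (elim x)
      have "ennreal (norm (f x + g x)) \<le> ennreal (norm (f x) + norm (g x))"
        by (intro ennreal_leI norm_triangle_ineq)
      then show ?case using elim by (metis ennreal_plus norm_ge_zero)
    qed
  qed
  also have "\<dots> = (\<integral>\<^sup>+x. ennreal (\<phi> x) \<partial>M) + (\<integral>\<^sup>+x. ennreal (\<psi> x) \<partial>M)"
    by (rule nn_integral_add) auto
  also have "(\<integral>\<^sup>+x. ennreal (\<phi> x) \<partial>M) = (\<integral>\<^sup>+x. norm (f x) \<partial>M)"
    using \<phi>_eq by (intro nn_integral_cong_AE) auto
  also have "(\<integral>\<^sup>+x. ennreal (\<psi> x) \<partial>M) = (\<integral>\<^sup>+x. norm (g x) \<partial>M)"
    using \<psi>_eq by (intro nn_integral_cong_AE) auto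
  finally show ?thesis .
qed

section \<open>Norm estimates for simple integrals and existence of the limit\<close>

abbreviation "bochner_simple \<equiv> Bochner_Integration.simple_bochner_integrable"
abbreviation "bochner_simple_integral \<equiv> Bochner_Integration.simple_bochner_integral"

lemma bochner_simple_imp_simple_function: "bochner_simple M s \<Longrightarrow> simple_function M s"
  by (auto elim: simple_bochner_integrable.cases)

lemma norm_simple_bochner_integral_le:
  fixes s :: "'a \<Rightarrow> 'b::real_normed_vector"
  assumes "bochner_simple M s"
  shows "ennreal (norm (bochner_simple_integral M s)) \<le> (\<integral>\<^sup>+x. norm (s x) \<partial>M)"
proof -
  have "ennreal (norm (bochner_simple_integral M s)) \<le> bochner_simple_integral M (\<lambda>x. norm (s x))"
    by (intro ennreal_leI simple_bochner_integral_norm_bound assms)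
  also have "\<dots> = (\<integral>\<^sup>+x. norm (s x) \<partial>M)"
    using simple_bochner_integrable_compose2[of "\<lambda>x y. norm x", OF _ assms assms]
    by (intro simple_bochner_integral_eq_nn_integral) auto
  finally show ?thesis .
qed

text \<open>With two members of one approximating sequence this is the Cauchy estimate; with
  \<open>t\<close> the zero function it bounds the integral by the integral of the norm.\<close>

lemma norm_simple_bochner_integral_diff_le:
  fixes f :: "'a \<Rightarrow> 'b::real_normed_vector"
  assumes f: "strongly_measurable M f" and s: "bochner_simple M s" and t: "bochner_simple M t"
  shows "ennreal (norm (bochner_simple_integral M s - bochner_simple_integral M t)) \<le>
    (\<integral>\<^sup>+x. norm (f x - s x) \<partial>M) + (\<integral>\<^sup>+x. norm (f x - t x) \<partial>M)"
proof -
  have ss: "strongly_measurable M s" "strongly_measurable M t"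
    using s t by (auto intro: strongly_measurable_simple bochner_simple_imp_simple_function)
  have "ennreal (norm (bochner_simple_integral M s - bochner_simple_integral M t)) = norm (bochner_simple_integral M (\<lambda>x. s x - t x))"
    using s t by (subst simple_bochner_integral_diff) auto
  also have "\<dots> \<le> (\<integral>\<^sup>+x. norm (s x - t x) \<partial>M)"
    using simple_bochner_integrable_compose2[of "(-)", OF _ s t]
    by (intro norm_simple_bochner_integral_le) auto
  also have "\<dots> = (\<integral>\<^sup>+x. norm ((s x - f x) + (f x - t x)) \<partial>M)" by simp
  also have "\<dots> \<le> (\<integral>\<^sup>+x. norm (s x - f x) \<partial>M) + (\<integral>\<^sup>+x. norm (f x - t x) \<partial>M)"
    by (intro nn_integral_norm_triangle strongly_measurable_diff f ss)
  finally show ?thesis by (simp add: norm_minus_commute)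
qed

lemma has_bochnerI:
  assumes "strongly_measurable M f" "\<And>i::nat. bochner_simple M (s i)"
    "(\<lambda>i. \<integral>\<^sup>+x. norm (f x - s i x) \<partial>M) \<longlonglongrightarrow> 0" "(\<lambda>i. bochner_simple_integral M (s i)) \<longlonglongrightarrow> I"
  shows "has_bochner M f I"
  using assms unfolding has_bochner_def by auto

lemma has_bochner_exI:
  fixes f :: "'a \<Rightarrow> 'b::banach"
  assumes f: "strongly_measurable M f" and s: "\<And>i::nat. bochner_simple M (s i)"
    and lim: "(\<lambda>i. \<integral>\<^sup>+x. norm (f x - s i x) \<partial>M) \<longlonglongrightarrow> 0"
  obtains I where "has_bochner M f I" "(\<lambda>i. bochner_simple_integral M (s i)) \<longlonglongrightarrow> I"
proof -
  have "Cauchy (\<lambda>i. bochner_simple_integral M (s i))"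
  proof (rule metric_CauchyI)
    fix e :: real assume e: "0 < e"
    have "\<forall>\<^sub>F i in sequentially. (\<integral>\<^sup>+x. norm (f x - s i x) \<partial>M) < ennreal (e/2)"
      using e by (intro order_tendstoD(2)[OF lim]) auto
    then obtain N where N: "\<And>i. i \<ge> N \<Longrightarrow> (\<integral>\<^sup>+x. norm (f x - s i x) \<partial>M) < ennreal (e/2)"
      by (auto simp: eventually_sequentially)
    show "\<exists>N. \<forall>m\<ge>N. \<forall>n\<ge>N. dist (bochner_simple_integral M (s m)) (bochner_simple_integral M (s n)) < e"
    proof (intro exI allI impI)
      fix m n assume mn: "m \<ge> N" "n \<ge> N"
      have "ennreal (norm (bochner_simple_integral M (s m) - bochner_simple_integral M (s n))) \<le>
        (\<integral>\<^sup>+x. norm (f x - s m x) \<partial>M) + (\<integral>\<^sup>+x. norm (f x - s n x) \<partial>M)"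
        by (rule norm_simple_bochner_integral_diff_le[OF f s s])
      also have "\<dots> < ennreal (e/2) + ennreal (e/2)"
        using N mn by (intro add_strict_mono) auto
      also have "\<dots> = ennreal e" using e by (simp flip: ennreal_plus)
      finally show "dist (bochner_simple_integral M (s m)) (bochner_simple_integral M (s n)) < e"
        using e by (simp add: dist_norm ennreal_less_iff)
    qed
  qed
  then obtain I where I: "(\<lambda>i. bochner_simple_integral M (s i)) \<longlonglongrightarrow> I"
    by (auto simp: Cauchy_convergent_iff convergent_def)
  have "has_bochner M f I"
    by (rule has_bochnerI[OF f s lim I])
  from that[OF this I] show ?thesis .
qed

lemma has_bochner_approx:
  fixes f :: "'a \<Rightarrow> 'b::real_normed_vector"
  assumes "has_bochner M f I"
  obtains s where "\<And>i::nat. bochner_simple M (s i)" "(\<lambda>i. \<integral>\<^sup>+x. norm (f x - s i x) \<partial>M) \<longlonglongrightarrow> 0"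
    "(\<lambda>i. bochner_simple_integral M (s i)) \<longlonglongrightarrow> I"
  using assms unfolding has_bochner_def by blast

lemma has_bochner_strongly_measurable: "has_bochner M f I \<Longrightarrow> strongly_measurable M f"
  unfolding has_bochner_def by blast

lemma has_bochner_norm_le:
  fixes f :: "'a \<Rightarrow> 'b::real_normed_vector"
  assumes "has_bochner M f I"
  shows "ennreal (norm I) \<le> (\<integral>\<^sup>+x. norm (f x) \<partial>M)"
proof -
  note f = has_bochner_strongly_measurable[OF assms]
  obtain s where s: "\<And>i::nat. bochner_simple M (s i)" "(\<lambda>i. \<integral>\<^sup>+x. norm (f x - s i x) \<partial>M) \<longlonglongrightarrow> 0"
    "(\<lambda>i. bochner_simple_integral M (s i)) \<longlonglongrightarrow> I"
    using has_bochner_approx[OF assms] by blast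
  have "ennreal (norm (bochner_simple_integral M (s i))) \<le> (\<integral>\<^sup>+x. norm (f x - s i x) \<partial>M) + (\<integral>\<^sup>+x. norm (f x) \<partial>M)" for i
  proof -
    have "bochner_simple M (\<lambda>x. 0::'b)"
      by (rule simple_bochner_integrable.intros) auto
    moreover have "bochner_simple_integral M (\<lambda>x. 0::'b) = 0"
      unfolding simple_bochner_integral_def by (rule sum.neutral) auto
    ultimately show ?thesis
      using norm_simple_bochner_integral_diff_le[OF f s(1)[of i], of "\<lambda>x. 0"] by simp
  qed
  moreover have "(\<lambda>i. ennreal (norm (bochner_simple_integral M (s i)))) \<longlonglongrightarrow> ennreal (norm I)"
    by (intro tendsto_ennrealI tendsto_norm s)
  moreover have "(\<lambda>i. (\<integral>\<^sup>+x. norm (f x - s i x) \<partial>M) + (\<integral>\<^sup>+x. norm (f x) \<partial>M)) \<longlonglongrightarrow>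
      0 + (\<integral>\<^sup>+x. norm (f x) \<partial>M)"
    by (intro tendsto_add s tendsto_const)
  ultimately show ?thesis
    by (intro LIMSEQ_le[of "\<lambda>i. ennreal (norm (bochner_simple_integral M (s i)))" _
       "\<lambda>i. (\<integral>\<^sup>+x. norm (f x - s i x) \<partial>M) + (\<integral>\<^sup>+x. norm (f x) \<partial>M)"]) auto
qed

section \<open>Linearity and uniqueness\<close>

lemma has_bochner_add:
  fixes f g :: "'a \<Rightarrow> 'b::real_normed_vector"
  assumes "has_bochner M f I" "has_bochner M g J"
  shows "has_bochner M (\<lambda>x. f x + g x) (I + J)"
proof -
  note sm = has_bochner_strongly_measurable[OF assms(1)] has_bochner_strongly_measurable[OF assms(2)]
  obtain s where s: "\<And>i::nat. bochner_simple M (s i)" "(\<lambda>i. \<integral>\<^sup>+x. norm (f x - s i x) \<partial>M) \<longlonglongrightarrow> 0"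
    "(\<lambda>i. bochner_simple_integral M (s i)) \<longlonglongrightarrow> I"
    using has_bochner_approx[OF assms(1)] by blast
  obtain r where r: "\<And>i::nat. bochner_simple M (r i)" "(\<lambda>i. \<integral>\<^sup>+x. norm (g x - r i x) \<partial>M) \<longlonglongrightarrow> 0"
    "(\<lambda>i. bochner_simple_integral M (r i)) \<longlonglongrightarrow> J"
    using has_bochner_approx[OF assms(2)] by blast
  have "(\<integral>\<^sup>+x. norm ((f x + g x) - (s i x + r i x)) \<partial>M) \<le>
      (\<integral>\<^sup>+x. norm (f x - s i x) \<partial>M) + (\<integral>\<^sup>+x. norm (g x - r i x) \<partial>M)" for i
    using nn_integral_norm_triangle[OF
      strongly_measurable_diff[OF sm(1) strongly_measurable_simple[OF bochner_simple_imp_simple_function[OF s(1)[of i]]]]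
      strongly_measurable_diff[OF sm(2) strongly_measurable_simple[OF bochner_simple_imp_simple_function[OF r(1)[of i]]]]]
    by (simp add: algebra_simps)
  moreover have "(\<lambda>i. (\<integral>\<^sup>+x. norm (f x - s i x) \<partial>M) + (\<integral>\<^sup>+x. norm (g x - r i x) \<partial>M)) \<longlonglongrightarrow> 0 + 0"
    by (intro tendsto_add s r)
  then have "(\<lambda>i. (\<integral>\<^sup>+x. norm (f x - s i x) \<partial>M) + (\<integral>\<^sup>+x. norm (g x - r i x) \<partial>M)) \<longlonglongrightarrow> 0" by simp
  ultimately have "(\<lambda>i. \<integral>\<^sup>+x. norm ((f x + g x) - (s i x + r i x)) \<partial>M) \<longlonglongrightarrow> 0"
    by (rule tendsto_sandwich[OF always_eventually[OF allI[OF zero_le]] always_eventually[OF allI] tendsto_const])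
  moreover have "(\<lambda>i. bochner_simple_integral M (\<lambda>x. s i x + r i x)) \<longlonglongrightarrow> I + J"
    using s r by (simp add: simple_bochner_integral_add tendsto_add)
  moreover have "bochner_simple M (\<lambda>x. s i x + r i x)" for i
    using simple_bochner_integrable_compose2[of "(+)", OF _ s(1) r(1)] by simp
  ultimately show ?thesis
    using strongly_measurable_add[OF sm] by (intro has_bochnerI[of M _ "\<lambda>i x. s i x + r i x"])
qed

lemma has_bochner_minus:
  fixes f :: "'a \<Rightarrow> 'b::real_normed_vector"
  assumes "has_bochner M f I"
  shows "has_bochner M (\<lambda>x. - f x) (- I)"
proof -
  note sm = has_bochner_strongly_measurable[OF assms(1)]
  obtain s where s: "\<And>i::nat. bochner_simple M (s i)" "(\<lambda>i. \<integral>\<^sup>+x. norm (f x - s i x) \<partial>M) \<longlonglongrightarrow> 0"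
    "(\<lambda>i. bochner_simple_integral M (s i)) \<longlonglongrightarrow> I"
    using has_bochner_approx[OF assms(1)] by blast
  have "strongly_measurable M (\<lambda>x. - f x)"
    using strongly_measurable_scaleR[OF sm, of "\<lambda>_. -1"] by simp
  moreover have "bochner_simple M (\<lambda>x. - s i x)" for i
    using simple_bochner_integrable_compose2[of "\<lambda>x y. - x", OF _ s(1) s(1)] by simp
  moreover have "norm (- f x - - s i x) = norm (f x - s i x)" for x i
    by (simp add: norm_minus_commute)
  moreover have "(\<lambda>i. bochner_simple_integral M (\<lambda>x. - s i x)) \<longlonglongrightarrow> - I"
    using s by (simp add: simple_bochner_integral_minus tendsto_minus)
  ultimately show ?thesis
    using s(2) by (intro has_bochnerI[of M _ "\<lambda>i x. - s i x"]) simp_all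
qed

lemma has_bochner_diff:
  fixes f g :: "'a \<Rightarrow> 'b::real_normed_vector"
  assumes "has_bochner M f I" "has_bochner M g J"
  shows "has_bochner M (\<lambda>x. f x - g x) (I - J)"
  using has_bochner_add[OF assms(1) has_bochner_minus[OF assms(2)]] by simp

text \<open>By linearity the zero function \<open>f - f\<close> has integral \<open>I - J\<close>,
  whose norm is at most the integral of 0. This is what makes the definite description in
  \<open>bochner_integral\<close> meaningful.\<close>

lemma has_bochner_unique:
  fixes f :: "'a \<Rightarrow> 'b::real_normed_vector"
  assumes "has_bochner M f I" "has_bochner M f J"
  shows "I = J"
  using has_bochner_norm_le[OF has_bochner_diff[OF assms]] by (simp add: ennreal_eq_0_iff)

lemma bochner_integral_eq:
  fixes f :: "'a \<Rightarrow> 'b::real_normed_vector"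
  shows "has_bochner M f I \<Longrightarrow> bochner_integral M f = I"
  unfolding bochner_integral_def bochner_integrable_def
  by (auto intro: the_equality has_bochner_unique)

lemma has_bochner_bochner_integral:
  fixes f :: "'a \<Rightarrow> 'b::real_normed_vector"
  shows "bochner_integrable M f \<Longrightarrow> has_bochner M f (bochner_integral M f)"
  unfolding bochner_integrable_def using bochner_integral_eq by blast

section \<open>Integrability as strong measurability with finite norm integral\<close>

lemma has_bochner_norm_finite:
  fixes f :: "'a \<Rightarrow> 'b::real_normed_vector"
  assumes "has_bochner M f I"
  shows "(\<integral>\<^sup>+x. norm (f x) \<partial>M) < \<infinity>"
proof -
  note f = has_bochner_strongly_measurable[OF assms]
  obtain s where s: "\<And>i::nat. bochner_simple M (s i)" "(\<lambda>i. \<integral>\<^sup>+x. norm (f x - s i x) \<partial>M) \<longlonglongrightarrow> 0"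
    using has_bochner_approx[OF assms] by blast
  have "\<forall>\<^sub>F i in sequentially. (\<integral>\<^sup>+x. norm (f x - s i x) \<partial>M) < 1"
    by (intro order_tendstoD(2)[OF s(2)]) auto
  then obtain i where i: "(\<integral>\<^sup>+x. norm (f x - s i x) \<partial>M) < 1"
    by (auto simp: eventually_sequentially)
  have "bochner_simple_integral M (\<lambda>x. norm (s i x)) = (\<integral>\<^sup>+x. norm (s i x) \<partial>M)"
    using simple_bochner_integrable_compose2[of "\<lambda>x y. norm x", OF _ s(1)[of i] s(1)[of i]]
    by (intro simple_bochner_integral_eq_nn_integral) auto
  then have fin: "(\<integral>\<^sup>+x. norm (s i x) \<partial>M) < \<infinity>"
    by (metis ennreal_less_top infinity_ennreal_def)
  have ss: "strongly_measurable M (s i)" by (intro strongly_measurable_simple bochner_simple_imp_simple_function s)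
  have "(\<integral>\<^sup>+x. norm (f x) \<partial>M) \<le> (\<integral>\<^sup>+x. norm (f x - s i x) \<partial>M) + (\<integral>\<^sup>+x. norm (s i x) \<partial>M)"
    using nn_integral_norm_triangle[OF strongly_measurable_diff[OF f ss] ss] by simp
  also have "\<dots> < \<infinity>" using i fin by (simp add: order_less_trans[OF i])
  finally show ?thesis .
qed

lemma bochner_integrableI:
  fixes f :: "'a \<Rightarrow> 'b::banach"
  assumes f: "strongly_measurable M f" and fin: "(\<integral>\<^sup>+x. norm (f x) \<partial>M) < \<infinity>"
  shows "bochner_integrable M f"
proof -
  obtain f' s where ae: "AE x in M. f x = f' x" and s: "\<And>i. simple_function M (s i)"
    and s_lim: "\<And>x. (\<lambda>i::nat. s i x) \<longlonglongrightarrow> f' x"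
    using strongly_measurable_pointwise[OF f] by blast
  have s_meas[measurable]: "s i \<in> borel_measurable M" for i
    using borel_measurable_simple_function[OF s] by simp
  have norm_f'[measurable]: "(\<lambda>x. norm (f' x)) \<in> borel_measurable M"
  proof (rule borel_measurable_LIMSEQ_metric)
    show "(\<lambda>i. norm (s i x)) \<longlonglongrightarrow> norm (f' x)" for x by (intro tendsto_norm s_lim)
  qed measurable
  have fin': "(\<integral>\<^sup>+x. norm (f' x) \<partial>M) < \<infinity>"
  proof -
    have "(\<integral>\<^sup>+x. norm (f' x) \<partial>M) = (\<integral>\<^sup>+x. norm (f x) \<partial>M)"
      using ae by (intro nn_integral_cong_AE) auto
    then show ?thesis using fin by simp
  qed
  \<comment> \<open>Truncation produces a dominated sequence. Where \<open>f' x\<close> is nonzero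
    the factor 2 leaves room, so eventually nothing is cut off; where \<open>f' x = 0\<close> only
    zero values remain.\<close>
  define B where "B i = {x\<in>space M. norm (s i x) \<le> 2 * norm (f' x)}" for i
  have B: "B i \<in> sets M" for i unfolding B_def by measurable
  define r where "r i x = indicator (B i) x *\<^sub>R s i x" for i x
  have r: "simple_function M (r i)" for i
    unfolding r_def by (rule simple_function_compose2[OF simple_function_indicator[OF B] s])
  have r_le: "norm (r i x) \<le> 2 * norm (f' x)" for i x
    unfolding r_def B_def by (auto simp: indicator_def)
  have r_lim: "(\<lambda>i. r i x) \<longlonglongrightarrow> f' x" if "x \<in> space M" for x
  proof (cases "f' x = 0")
    case True
    then have "r i x = 0" for i using r_le[of i x] by simp
    then show ?thesis using True by simp
  next
    case False
    have "\<forall>\<^sub>F i in sequentially. norm (s i x) < 2 * norm (f' x)"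
      using False by (intro order_tendstoD(2)[OF tendsto_norm[OF s_lim]]) auto
    then have "\<forall>\<^sub>F i in sequentially. s i x = r i x"
      by eventually_elim (auto simp: r_def B_def that)
    then show ?thesis using s_lim[of x] by (rule Lim_transform_eventually[rotated])
  qed
  have "bochner_simple M (r i)" for i
  proof (rule simple_bochner_integrableI_bounded[OF r])
    have "(\<integral>\<^sup>+x. norm (r i x) \<partial>M) \<le> (\<integral>\<^sup>+x. 2 * ennreal (norm (f' x)) \<partial>M)"
    proof (rule nn_integral_mono)
      fix x show "ennreal (norm (r i x)) \<le> 2 * ennreal (norm (f' x))"
        using ennreal_leI[OF r_le[of i x]] by (simp add: ennreal_mult)
    qed
    also have "\<dots> < \<infinity>" using fin' by (simp add: nn_integral_cmult ennreal_mult_less_top)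
    finally show "(\<integral>\<^sup>+x. norm (r i x) \<partial>M) < \<infinity>" .
  qed
  moreover have "(\<lambda>i. \<integral>\<^sup>+x. norm (f x - r i x) \<partial>M) \<longlonglongrightarrow> 0"
  proof -
    have meas: "(\<lambda>x. norm (f' x - r i x)) \<in> borel_measurable M" for i
    proof (rule borel_measurable_LIMSEQ_metric)
      show "(\<lambda>x. norm (r j x - r i x)) \<in> borel_measurable M" for j
        by (rule borel_measurable_simple_function, rule simple_function_compose2[OF r r])
      show "(\<lambda>j. norm (r j x - r i x)) \<longlonglongrightarrow> norm (f' x - r i x)" if "x \<in> space M" for x
        by (intro tendsto_intros r_lim that)
    qed
    have "(\<lambda>i. \<integral>\<^sup>+x. norm (f' x - r i x) \<partial>M) \<longlonglongrightarrow> (\<integral>\<^sup>+x. 0 \<partial>M)"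
    \<comment> \<open>The 3 is 1 for \<open>f'\<close> plus 2 for the truncated approximant.\<close>
    proof (rule nn_integral_dominated_convergence[where w = "\<lambda>x. 3 * ennreal (norm (f' x))"])
      show "(\<integral>\<^sup>+x. 3 * ennreal (norm (f' x)) \<partial>M) < \<infinity>"
        using fin' by (simp add: nn_integral_cmult ennreal_mult_less_top)
      show "AE x in M. ennreal (norm (f' x - r i x)) \<le> 3 * ennreal (norm (f' x))" for i
      proof (rule AE_I2)
        fix x
        have "norm (f' x - r i x) \<le> 3 * norm (f' x)"
          using norm_triangle_ineq4[of "f' x" "r i x"] r_le[of i x] by linarith
        from ennreal_leI[OF this]
        show "ennreal (norm (f' x - r i x)) \<le> 3 * ennreal (norm (f' x))"
          by (simp add: ennreal_mult)
      qed
      show "AE x in M. (\<lambda>i. ennreal (norm (f' x - r i x))) \<longlonglongrightarrow> 0"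
      proof (rule AE_I2)
        fix x assume "x \<in> space M"
        then have "(\<lambda>i. norm (f' x - r i x)) \<longlonglongrightarrow> norm (f' x - f' x)"
          by (intro tendsto_intros r_lim)
        then show "(\<lambda>i. ennreal (norm (f' x - r i x))) \<longlonglongrightarrow> 0"
          using tendsto_ennrealI by fastforce
      qed
    qed (use meas in auto)
    moreover have "(\<integral>\<^sup>+x. norm (f x - r i x) \<partial>M) = (\<integral>\<^sup>+x. norm (f' x - r i x) \<partial>M)" for i
      using ae by (intro nn_integral_cong_AE) auto
    ultimately show ?thesis by simp
  qed
  ultimately obtain I where "has_bochner M f I"
    using has_bochner_exI[OF f] by blast
  then show ?thesis by (auto simp: bochner_integrable_def)
qed

lemma has_bochner_const:
  fixes c :: "'b::real_normed_vector"
  assumes "B \<in> sets M" "emeasure M B < \<infinity>"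
  shows "has_bochner M (\<lambda>x. indicator B x *\<^sub>R c) (measure M B *\<^sub>R c)"
proof -
  have sf: "simple_function M (indicator B :: _ \<Rightarrow> real)"
    by (rule simple_function_indicator[OF assms(1)])
  have eq: "{y \<in> space M. indicator B y \<noteq> (0::real)} = B"
    using sets.sets_into_space[OF assms(1)] by (auto simp: indicator_def)
  have s1: "bochner_simple M (indicator B :: _ \<Rightarrow> real)"
    by (rule simple_bochner_integrable.intros[OF sf]) (use assms eq in auto)
  have s2: "bochner_simple M (\<lambda>x. indicator B x *\<^sub>R c)"
    using simple_bochner_integrable_compose2[of "\<lambda>x y. x *\<^sub>R c", OF _ s1 s1] by simp
  have "linear (\<lambda>x. x *\<^sub>R c)" by (simp add: linear_scaleR_left)
  from simple_bochner_integral_linear[OF this s1]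
  have "bochner_simple_integral M (\<lambda>x. indicator B x *\<^sub>R c) = bochner_simple_integral M (indicator B :: _ \<Rightarrow> real) *\<^sub>R c" .
  also have "bochner_simple_integral M (indicator B :: _ \<Rightarrow> real) = measure M B"
    using has_bochner_integral_eq[OF has_bochner_integral_simple_bochner_integrable[OF s1]
      has_bochner_integral_real_indicator[OF assms]] .
  finally have "bochner_simple_integral M (\<lambda>x. indicator B x *\<^sub>R c) = measure M B *\<^sub>R c" .
  with s2 show ?thesis
    by (intro has_bochnerI[of M _ "\<lambda>i x. indicator B x *\<^sub>R c"] strongly_measurable_simple bochner_simple_imp_simple_function)
      simp_all
qed

lemma bochner_integrable_restrict:
  fixes f :: "'a \<Rightarrow> 'b::banach"
  assumes "has_bochner M f I" "B \<in> sets M"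
  shows "bochner_integrable M (\<lambda>x. indicator B x *\<^sub>R f x)"
proof (rule bochner_integrableI)
  show "strongly_measurable M (\<lambda>x. indicator B x *\<^sub>R f x)"
    by (intro strongly_measurable_scaleR has_bochner_strongly_measurable[OF assms(1)]
      simple_function_indicator assms)
  have "(\<integral>\<^sup>+x. norm (indicator B x *\<^sub>R f x) \<partial>M) \<le> (\<integral>\<^sup>+x. norm (f x) \<partial>M)"
    by (intro nn_integral_mono ennreal_leI) (auto simp: indicator_def)
  then show "(\<integral>\<^sup>+x. norm (indicator B x *\<^sub>R f x) \<partial>M) < \<infinity>"
    using has_bochner_norm_finite[OF assms(1)] by (rule le_less_trans)
qed

text \<open>The distance to the positive cone is sublinear, so the distance of a simple integral
  to the cone is at most the integral of the distance.\<close>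

lemma has_bochner_nonneg:
  fixes f :: "'a \<Rightarrow> 'b::ordered_banach"
  assumes f: "has_bochner M f I" and nonneg: "\<And>x. x \<in> space M \<Longrightarrow> 0 \<le> f x"
  shows "0 \<le> I"
proof -
  let ?C = "{x::'b. 0 \<le> x}"
  define d where "d x = infdist x ?C" for x :: 'b
  have C: "?C \<noteq> {}" by auto
  have d_le: "d x \<le> norm (y - x)" if "0 \<le> y" for x y
    unfolding d_def using infdist_le[of y ?C x] that by (simp add: dist_norm norm_minus_commute)
  have d0: "d x \<ge> 0" for x unfolding d_def by (rule infdist_nonneg)
  \<comment> \<open>The distance to the cone need not be attained, so sublinearity is shown with
    nearly optimal points: sums and positive multiples of these stay in the cone.\<close>
  have approx: "\<exists>y\<ge>0. norm (y - x) < d x + e" if "e > 0" for x e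
  proof (rule ccontr)
    assume "\<not> ?thesis"
    then have "d x + e \<le> dist x y" if "y \<in> ?C" for y
      using that by (force simp: dist_norm norm_minus_commute not_less)
    then have "d x + e \<le> d x"
      unfolding d_def infdist_notempty[OF C] using C by (intro cINF_greatest)
    then show False using that by simp
  qed
  have d_add: "d (x + y) \<le> d x + d y" for x y
  proof (rule field_le_epsilon)
    fix e :: real assume "e > 0"
    then obtain a b where ab: "a \<ge> 0" "b \<ge> 0" "norm (a - x) < d x + e/2" "norm (b - y) < d y + e/2"
      using approx[of "e/2" x] approx[of "e/2" y] by auto
    have "d (x + y) \<le> norm ((a + b) - (x + y))" by (rule d_le) (use ab in auto)
    also have "\<dots> = norm ((a - x) + (b - y))" by (simp add: algebra_simps)
    also have "\<dots> \<le> norm (a - x) + norm (b - y)" by (rule norm_triangle_ineq)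
    finally show "d (x + y) \<le> d x + d y + e" using ab by linarith
  qed
  have d_scale: "d (c *\<^sub>R x) \<le> c * d x" if c: "c \<ge> 0" for c x
  proof (cases "c = 0")
    case True
    then show ?thesis using d_le[of 0 "c *\<^sub>R x"] by simp
  next
    case False
    with c have c: "c > 0" by simp
    show ?thesis
    proof (rule field_le_epsilon)
      fix e :: real assume "e > 0"
      then obtain a where a: "a \<ge> 0" "norm (a - x) < d x + e/c"
        using approx[of "e/c" x] c by auto
      have "d (c *\<^sub>R x) \<le> norm (c *\<^sub>R a - c *\<^sub>R x)"
        by (rule d_le) (use a c in \<open>auto intro: scaleR_nonneg_nonneg\<close>)
      also have "\<dots> = c * norm (a - x)" using c by (simp flip: scaleR_diff_right)
      also have "\<dots> \<le> c * (d x + e/c)" using a c by (intro mult_left_mono) auto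
      finally show "d (c *\<^sub>R x) \<le> c * d x + e" using c by (simp add: distrib_left)
    qed
  qed
  have d_sum: "d (\<Sum>y\<in>Y. g y) \<le> (\<Sum>y\<in>Y. d (g y))" if "finite Y" for Y and g :: "'b \<Rightarrow> 'b"
    using that
  proof (induction Y rule: finite_induct)
    case empty
    show ?case using d_le[of 0 0] by simp
  next
    case (insert y Y)
    then show ?case using d_add[of "g y" "sum g Y"] by simp
  qed
  obtain s where s: "\<And>i::nat. bochner_simple M (s i)" "(\<lambda>i. \<integral>\<^sup>+x. norm (f x - s i x) \<partial>M) \<longlonglongrightarrow> 0"
    "(\<lambda>i. bochner_simple_integral M (s i)) \<longlonglongrightarrow> I"
    using has_bochner_approx[OF f] by blast
  have bound: "ennreal (d (bochner_simple_integral M (s i))) \<le> (\<integral>\<^sup>+x. norm (f x - s i x) \<partial>M)" for i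
  proof -
    have fin: "finite (s i ` space M)" using bochner_simple_imp_simple_function[OF s(1)[of i]] by (simp add: simple_function_def)
    have d00: "d 0 = 0" using d_le[of 0 0] d0[of 0] by simp
    have ds: "bochner_simple M (\<lambda>x. d (s i x))"
      using simple_bochner_integrable_compose2[of "\<lambda>x y. d x", OF _ s(1)[of i] s(1)[of i]] d00 by simp
    have "d (bochner_simple_integral M (s i)) \<le> (\<Sum>y\<in>s i ` space M. d (measure M {x\<in>space M. s i x = y} *\<^sub>R y))"
      unfolding simple_bochner_integral_def by (rule d_sum[OF fin])
    also have "\<dots> \<le> (\<Sum>y\<in>s i ` space M. measure M {x\<in>space M. s i x = y} *\<^sub>R d y)"
      by (intro sum_mono) (simp add: d_scale)
    also have "\<dots> = bochner_simple_integral M (\<lambda>x. d (s i x))"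
      by (rule simple_bochner_integral_partition[symmetric, OF ds bochner_simple_imp_simple_function[OF s(1)]]) auto
    finally have "ennreal (d (bochner_simple_integral M (s i))) \<le> ennreal (bochner_simple_integral M (\<lambda>x. d (s i x)))" by (rule ennreal_leI)
    also have "\<dots> = (\<integral>\<^sup>+x. d (s i x) \<partial>M)"
      by (rule simple_bochner_integral_eq_nn_integral[OF ds d0])
    \<comment> \<open>Here \<open>f x\<close> itself is the competing point of the cone, which is
      where nonnegativity of \<open>f\<close> enters.\<close>
    also have "\<dots> \<le> (\<integral>\<^sup>+x. norm (f x - s i x) \<partial>M)"
      by (intro nn_integral_mono ennreal_leI d_le nonneg)
    finally show ?thesis .
  qed
  have "(\<lambda>i. ennreal (d (bochner_simple_integral M (s i)))) \<longlonglongrightarrow> ennreal (d I)"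
    unfolding d_def by (intro tendsto_ennrealI tendsto_infdist s)
  then have "ennreal (d I) \<le> 0"
    using s(2) bound by (intro LIMSEQ_le[of "\<lambda>i. ennreal (d (bochner_simple_integral M (s i)))"]) auto
  then have "d I \<le> 0" by (simp add: ennreal_eq_0_iff)
  then have "infdist I ?C = 0" using d0[of I] unfolding d_def by linarith
  then have "I \<in> ?C"
    by (subst in_closed_iff_infdist_zero[OF closed_cone C])
  then show ?thesis by simp
qed

lemma has_bochner_mono:
  fixes f :: "'a \<Rightarrow> 'b::ordered_banach"
  assumes "has_bochner M f I" "has_bochner M g J" "\<And>x. x \<in> space M \<Longrightarrow> f x \<le> g x"
  shows "I \<le> J"
  using has_bochner_nonneg[OF has_bochner_diff[OF assms(2,1)]] assms(3) by simp

section \<open>Almost everywhere continuity of decreasing functions\<close>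

lemma ordered_banach_limit_nonneg:
  fixes f :: "'a \<Rightarrow> 'e::ordered_banach"
  assumes "(f \<longlongrightarrow> l) G" "\<forall>\<^sub>F x in G. 0 \<le> f x" "G \<noteq> bot"
  shows "0 \<le> l"
  using Lim_in_closed_set[OF closed_cone _ assms(3,1)] assms(2) by simp

lemma ordered_banach_limit_le:
  fixes f g :: "'a \<Rightarrow> 'e::ordered_banach"
  assumes "(f \<longlongrightarrow> l) G" "(g \<longlongrightarrow> k) G" "\<forall>\<^sub>F x in G. f x \<le> g x" "G \<noteq> bot"
  shows "l \<le> k"
  using ordered_banach_limit_nonneg[OF tendsto_diff[OF assms(2,1)] _ assms(4)] assms(3) by simp

text \<open>Closedness of the cone allows the passage to the limit. The comparisons of primitives
  below end here, with \<open>w\<close> the error of a single cell of full length.\<close>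

lemma ordered_banach_archimedean:
  fixes x w :: "'e::ordered_banach"
  assumes "\<And>n::nat. x \<le> (1 / real (Suc n)) *\<^sub>R w"
  shows "x \<le> 0"
proof -
  have "(\<lambda>n. (1 / real (Suc n)) *\<^sub>R w) \<longlonglongrightarrow> 0 *\<^sub>R w"
    by (intro tendsto_scaleR tendsto_const LIMSEQ_Suc lim_1_over_n)
  then have "(\<lambda>n. (1 / real (Suc n)) *\<^sub>R w) \<longlonglongrightarrow> 0" by simp
  then show ?thesis
    by (rule ordered_banach_limit_le[OF tendsto_const]) (use assms in auto)
qed

lemma norm_diff_mono:
  fixes a b c :: "'e::ordered_banach"
  assumes "a \<le> b" "b \<le> c"
  shows "norm (b - a) \<le> norm (c - a)" "norm (c - b) \<le> norm (c - a)"
  using assms by (auto intro!: norm_mono_cone)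

text \<open>Each \<open>F t\<close> has a point of \<open>C\<close> within \<open>e/2\<close>, and
  two values at distance at least \<open>e\<close> cannot share one, so \<open>B\<close> injects
  into \<open>C\<close>.\<close>

lemma countable_separated:
  fixes F :: "'a \<Rightarrow> 'b::metric_space"
  assumes C: "countable C" and cl: "\<And>t. t \<in> B \<Longrightarrow> F t \<in> closure C"
    and e: "e > 0" and sep: "\<And>s t. s \<in> B \<Longrightarrow> t \<in> B \<Longrightarrow> s \<noteq> t \<Longrightarrow> e \<le> dist (F s) (F t)"
  shows "countable B"
proof -
  have "\<exists>c\<in>C. dist c (F t) < e/2" if "t \<in> B" for t
    by (rule closure_approachable[THEN iffD1, OF cl[OF that], rule_format, OF half_gt_zero[OF e]])
  then obtain c where c: "\<And>t. t \<in> B \<Longrightarrow> c t \<in> C" "\<And>t. t \<in> B \<Longrightarrow> dist (c t) (F t) < e/2"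
    by metis
  have "inj_on c B"
  proof (rule inj_onI, rule ccontr)
    fix s t assume st: "s \<in> B" "t \<in> B" "c s = c t" "s \<noteq> t"
    have "dist (F s) (F t) \<le> dist (c s) (F s) + dist (c s) (F t)"
      by (metis dist_commute dist_triangle)
    also have "\<dots> < e" using c(2)[OF st(1)] c(2)[OF st(2)] st(3) by simp
    finally show False using sep[OF st(1,2,4)] by simp
  qed
  moreover have "countable (c ` B)" using c(1) by (intro countable_subset[OF _ C]) auto
  ultimately show ?thesis using countable_image_inj_on by blast
qed

text \<open>A point that is isolated from one side at distance \<open>e\<close> within the set where \<open>F\<close> takes its
  values in a separable set is separated from all other such points, so there are only countably
  many of them; elsewhere monotonicity squeezes \<open>F\<close>.\<close>

lemma antimono_AE_isCont:
  fixes F :: "real \<Rightarrow> 'e::ordered_banach"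
  assumes F: "antimono F" and C: "countable C" and ae: "AE t in lborel. F t \<in> closure C"
  shows "AE t in lborel. isCont F t"
proof -
  define D where "D = {t. F t \<in> closure C}"
  \<comment> \<open>A point of \<open>D\<close> with no point of \<open>D\<close> to its right
    belongs to \<open>R e\<close> vacuously, and likewise for \<open>L e\<close> on the left.
    Outside \<open>Bad\<close> the squeezing points on both sides therefore exist without a density
    argument for \<open>D\<close>.\<close>
  define R where "R e = {t\<in>D. \<forall>s\<in>D. t < s \<longrightarrow> e \<le> dist (F t) (F s)}" for e :: real
  define L where "L e = {t\<in>D. \<forall>s\<in>D. s < t \<longrightarrow> e \<le> dist (F t) (F s)}" for e :: real
  have R: "countable (R e)" if "e > 0" for e
  proof (rule countable_separated[OF C, of _ F, OF _ that])
    fix s t assume "s \<in> R e" "t \<in> R e" "s \<noteq> t"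
    then show "e \<le> dist (F s) (F t)"
      unfolding R_def by (cases "s < t") (auto simp: dist_commute)
  qed (auto simp: R_def D_def)
  have L: "countable (L e)" if "e > 0" for e
  proof (rule countable_separated[OF C, of _ F, OF _ that])
    fix s t assume "s \<in> L e" "t \<in> L e" "s \<noteq> t"
    then show "e \<le> dist (F s) (F t)"
      unfolding L_def by (cases "s < t") (auto simp: dist_commute)
  qed (auto simp: L_def D_def)
  define Bad where "Bad = (\<Union>n. R (1 / real (Suc n)) \<union> L (1 / real (Suc n)))"
  have "countable Bad" unfolding Bad_def by (intro countable_UN countable_Un R L) auto
  then have "AE t in lborel. t \<notin> Bad"
    by (intro AE_not_in countable_imp_null_set_lborel)
  with ae show ?thesis
  proof eventually_elim
    case (elim t)
    then have t: "t \<in> D" by (simp add: D_def)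
    show ?case
      unfolding continuous_at_eps_delta
    proof (intro allI impI)
      fix e :: real assume "e > 0"
      then obtain n where n: "1 / real (Suc n) < e" using nat_approx_posE by blast
      have "t \<notin> R (1 / real (Suc n))" "t \<notin> L (1 / real (Suc n))" using elim by (auto simp: Bad_def)
      then obtain s1 s2 where s: "t < s1" "dist (F t) (F s1) < 1 / real (Suc n)"
        "s2 < t" "dist (F t) (F s2) < 1 / real (Suc n)"
        using t unfolding R_def L_def by (auto simp: not_le)
      show "\<exists>d>0. \<forall>x'. dist x' t < d \<longrightarrow> dist (F x') (F t) < e"
      proof (intro exI[of _ "min (s1 - t) (t - s2)"] conjI allI impI)
        fix r assume r: "dist r t < min (s1 - t) (t - s2)"
        then have r': "s2 \<le> r" "r \<le> s1" by (auto simp: dist_real_def)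
        show "dist (F r) (F t) < e"
        proof (cases "t \<le> r")
          case True
          have "norm (F t - F r) \<le> norm (F t - F s1)"
            using antimonoD[OF F True] antimonoD[OF F r'(2)] by (intro norm_diff_mono) auto
          then show ?thesis using s n by (simp add: dist_norm norm_minus_commute)
        next
          case False
          then have "norm (F r - F t) \<le> norm (F s2 - F t)"
            using antimonoD[OF F, of r t] antimonoD[OF F r'(1)] by (intro norm_diff_mono) auto
          then show ?thesis using s n by (simp add: dist_norm norm_minus_commute)
        qed
      qed (use s in auto)
    qed
  qed
qed

lemma AE_lborel_lebesgue_on:
  assumes "AE t in lborel. P t" "K \<in> sets lebesgue"
  shows "AE t in lebesgue_on K. P t"
  using AE_completion[OF assms(1)] assms(2) by (subst AE_restrict_space_iff) auto

section \<open>Continuity almost everywhere, strong measurability and separable range\<close>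

lemma strongly_measurable_AE_isCont:
  fixes f :: "real \<Rightarrow> 'b::real_normed_vector"
  assumes ae: "AE t in lborel. isCont f t" and K: "K \<in> sets lebesgue"
  shows "strongly_measurable (lebesgue_on K) f"
proof -
  \<comment> \<open>\<open>c n t / real (Suc n)\<close> is \<open>t\<close> clipped to [-n, n] and
    rounded down to a grid of mesh 1/(n+1). It takes finitely many values, so its composition with
    \<open>f\<close> is simple, and it converges to \<open>t\<close>, which suffices at continuity
    points of \<open>f\<close>.\<close>
  define c where "c n t = real_of_int \<lfloor>max (- real n) (min (real n) t) * real (Suc n)\<rfloor>" for n :: nat and t :: real
  have c_simple: "simple_function (lebesgue_on K) (c n)" for n
  proof (rule simple_function_borel_measurable)
    have "c n \<in> borel_measurable borel" unfolding c_def by measurable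
    then show "c n \<in> borel_measurable (lebesgue_on K)"
      by (intro measurable_restrict_space1 measurable_completion) simp
    have "c n t \<in> real_of_int ` {\<lfloor>- real n * real (Suc n)\<rfloor>..\<lfloor>real n * real (Suc n)\<rfloor>}" for t
      unfolding c_def by (intro imageI) (simp only: atLeastAtMost_iff, intro conjI floor_mono mult_right_mono; simp)
    then show "finite (c n ` space (lebesgue_on K))"
      by (intro finite_subset[OF _ finite_imageI[OF finite_atLeastAtMost_int]]) auto
  qed
  have lim: "(\<lambda>n. c n t / real (Suc n)) \<longlonglongrightarrow> t" for t
  proof (rule LIMSEQ_I)
    fix e :: real assume "e > 0"
    then obtain N where N: "1 / real (Suc N) < e" using nat_approx_posE by blast
    obtain M :: nat where M: "\<bar>t\<bar> \<le> real M" using real_arch_simple by blast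
    show "\<exists>no. \<forall>n\<ge>no. norm (c n t / real (Suc n) - t) < e"
    proof (intro exI[of _ "max N M"] allI impI)
      fix n assume n: "n \<ge> max N M"
      then have "max (- real n) (min (real n) t) = t" using M by auto
      then have c: "c n t = real_of_int \<lfloor>t * real (Suc n)\<rfloor>" by (simp add: c_def)
      have "\<bar>c n t - t * real (Suc n)\<bar> \<le> 1" unfolding c by linarith
      moreover have "c n t / real (Suc n) - t = (c n t - t * real (Suc n)) / real (Suc n)"
        by (simp add: diff_divide_distrib)
      ultimately have "\<bar>c n t / real (Suc n) - t\<bar> \<le> 1 / real (Suc n)"
        by (simp add: abs_divide divide_right_mono)
      also have "\<dots> \<le> 1 / real (Suc N)" using n by (intro divide_left_mono) auto
      finally show "norm (c n t / real (Suc n) - t) < e" using N by simp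
    qed
  qed
  have "AE t in lebesgue_on K. (\<lambda>n. f (c n t / real (Suc n))) \<longlonglongrightarrow> f t"
    using AE_lborel_lebesgue_on[OF ae K] by eventually_elim (rule isCont_tendsto_compose[OF _ lim])
  moreover have "simple_function (lebesgue_on K) (\<lambda>t. f (c n t / real (Suc n)))" for n
    by (rule simple_function_compose1[OF c_simple])
  ultimately show ?thesis
    unfolding strongly_measurable_def by (intro exI[of _ "\<lambda>n t. f (c n t / real (Suc n))"]) auto
qed

text \<open>All the approximating simple functions together take only countably many values. This
  supplies the set \<open>C\<close> for the continuity theorem on decreasing functions.\<close>

lemma strongly_measurable_separable:
  assumes "strongly_measurable M f"
  obtains C where "countable C" "AE x in M. f x \<in> closure C"
proof -
  obtain s where s: "\<And>i::nat. simple_function M (s i)" "AE x in M. (\<lambda>i::nat. s i x) \<longlonglongrightarrow> f x"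
    using assms unfolding strongly_measurable_def by blast
  have "countable (\<Union>i. s i ` space M)"
    using s(1) by (intro countable_UN) (auto simp: simple_function_def countable_finite)
  moreover have "AE x in M. f x \<in> closure (\<Union>i. s i ` space M)"
    using s(2) AE_space
  proof eventually_elim
    case (elim x)
    then show ?case unfolding closure_sequential by (intro exI[of _ "\<lambda>i. s i x"]) auto
  qed
  ultimately show ?thesis by (rule that)
qed

lemma AE_lebesgue_on_Un:
  assumes "AE t in lebesgue_on K. P t" "AE t in lebesgue_on L. P t"
    "K \<in> sets lebesgue" "L \<in> sets lebesgue" "K \<union> L = UNIV"
  shows "AE t in lborel. P (t::real)"
proof -
  have "AE t in lebesgue. t \<in> K \<longrightarrow> P t" "AE t in lebesgue. t \<in> L \<longrightarrow> P t"
    using assms by (simp_all add: AE_restrict_space_iff)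
  then have "AE t in lebesgue. P t"
    by eventually_elim (use assms(5) in auto)
  then show ?thesis by (simp add: AE_completion_iff)
qed

section \<open>Preimages of null sets under complementary monotone functions\<close>

text \<open>Because \<open>v\<close> does not decrease, an increment of \<open>u\<close> is at most
  the increment of the identity.\<close>

lemma complementary_mono_lipschitz:
  fixes u v :: "real \<Rightarrow> real"
  assumes "mono u" "mono v" "\<And>t. u t + v t = t"
  shows "\<bar>u t - u s\<bar> \<le> \<bar>t - s\<bar>"
  using monoD[OF assms(1), of s t] monoD[OF assms(1), of t s]
    monoD[OF assms(2), of s t] monoD[OF assms(2), of t s] assms(3)[of s] assms(3)[of t]
  by (cases "s \<le> t") auto

text \<open>The image of Lebesgue measure under the right inverse \<tau> is the Stieltjes measure of
  \<open>u\<close>: the preimage of an open interval (l, r) under \<tau> lies between the open and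
  the closed interval with ends \<open>u l\<close> and \<open>u r\<close>, which have the same
  length.\<close>

lemma surj_mono_section:
  fixes u :: "real \<Rightarrow> real"
  assumes mono: "mono u" and cont: "continuous_on UNIV u" and surj: "surj u"
  obtains \<tau> where "mono \<tau>" "\<And>s. u (\<tau> s) = s"
    "\<And>l r. l \<le> r \<Longrightarrow> emeasure lborel {s. l < \<tau> s \<and> \<tau> s < r} = ennreal (u r - u l)"
proof -
  define \<tau> where "\<tau> = inv u"
  have u\<tau>: "u (\<tau> s) = s" for s unfolding \<tau>_def by (rule surj_f_inv_f[OF surj])
  have \<tau>_mono: "mono \<tau>"
    using u\<tau> by (metis mono mono_def linorder_linear mono_onI order_antisym)
  have lt: "u l < s \<Longrightarrow> l < \<tau> s" "s < u l \<Longrightarrow> \<tau> s < l" for l s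
    using u\<tau> monoD[OF mono] by (metis not_less)+
  have "emeasure lborel {s. l < \<tau> s \<and> \<tau> s < r} = ennreal (u r - u l)" if lr: "l \<le> r" for l r
  proof (rule antisym)
    have [measurable]: "\<tau> \<in> borel_measurable borel" by (rule borel_measurable_mono[OF \<tau>_mono])
    have m: "{s. l < \<tau> s \<and> \<tau> s < r} \<in> sets lborel" by measurable
    have ul: "u l \<le> u r" using mono lr by (rule monoD)
    have "{s. l < \<tau> s \<and> \<tau> s < r} \<subseteq> {u l..u r}"
      using u\<tau> monoD[OF mono] by (auto simp: less_imp_le) (metis less_imp_le)+
    then have "emeasure lborel {s. l < \<tau> s \<and> \<tau> s < r} \<le> emeasure lborel {u l..u r}"
      by (intro emeasure_mono) auto
    then show "emeasure lborel {s. l < \<tau> s \<and> \<tau> s < r} \<le> ennreal (u r - u l)"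
      using ul by simp
    have "{u l<..<u r} \<subseteq> {s. l < \<tau> s \<and> \<tau> s < r}" using lt by auto
    then have "emeasure lborel {u l<..<u r} \<le> emeasure lborel {s. l < \<tau> s \<and> \<tau> s < r}"
      by (rule emeasure_mono[OF _ m])
    then show "ennreal (u r - u l) \<le> emeasure lborel {s. l < \<tau> s \<and> \<tau> s < r}"
      using ul by simp
  qed
  with \<tau>_mono u\<tau> show ?thesis by (rule that)
qed

text \<open>If \<open>u\<close> and \<open>v\<close> have inverses \<open>\<sigma>\<close> and \<open>\<tau>\<close>, then Lebesgue measure is the sum of its images under
  \<open>\<sigma>\<close> and \<open>\<tau>\<close>, and these do not charge the preimages of null sets under \<open>u\<close> and \<open>v\<close>, respectively.\<close>

lemma AE_complementary_mono_surj:
  fixes u v :: "real \<Rightarrow> real"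
  assumes mono: "mono u" "mono v" and sum: "\<And>t. u t + v t = t" and surj: "surj u" "surj v"
    and P: "AE t in lborel. P t" and Q: "AE t in lborel. Q t"
  shows "AE t in lborel. P (u t) \<or> Q (v t)"
proof -
  have cont: "continuous_on UNIV u" "continuous_on UNIV v"
    using complementary_mono_lipschitz[OF mono sum] complementary_mono_lipschitz[OF mono(2,1)] sum
    by (auto intro!: lipschitz_on_continuous_on[of 1] lipschitz_onI simp: dist_real_def add.commute)
  obtain \<sigma> where \<sigma>: "mono \<sigma>" "\<And>s. u (\<sigma> s) = s"
    "\<And>l r. l \<le> r \<Longrightarrow> emeasure lborel {s. l < \<sigma> s \<and> \<sigma> s < r} = ennreal (u r - u l)"
    using surj_mono_section[OF mono(1) cont(1) surj(1)] by blast
  obtain \<tau> where \<tau>: "mono \<tau>" "\<And>s. v (\<tau> s) = s"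
    "\<And>l r. l \<le> r \<Longrightarrow> emeasure lborel {s. l < \<tau> s \<and> \<tau> s < r} = ennreal (v r - v l)"
    using surj_mono_section[OF mono(2) cont(2) surj(2)] by blast
  have [measurable]: "\<sigma> \<in> borel_measurable borel" "\<tau> \<in> borel_measurable borel"
    "u \<in> borel_measurable borel" "v \<in> borel_measurable borel"
    using borel_measurable_mono \<sigma>(1) \<tau>(1) mono by blast+
  define M1 where "M1 = distr lborel borel \<sigma>"
  define M2 where "M2 = distr lborel borel \<tau>"
  define M where "M = measure_of UNIV (sets borel) (\<lambda>A::real set. emeasure M1 A + emeasure M2 A)"
  have sets_M: "sets M = sets borel" unfolding M_def using sets.sigma_sets_eq[of "borel :: real measure"] by simp
  have emeasure_M: "emeasure M A = emeasure M1 A + emeasure M2 A" if "A \<in> sets borel" for A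
  proof (rule emeasure_measure_of[OF M_def])
    show "countably_additive (sets M) (\<lambda>A. emeasure M1 A + emeasure M2 A)"
      unfolding sets_M
    proof (rule countably_additiveI)
      fix A :: "nat \<Rightarrow> real set" assume A: "range A \<subseteq> sets borel" "disjoint_family A"
      have "(\<Sum>i. emeasure M1 (A i) + emeasure M2 (A i)) = (\<Sum>i. emeasure M1 (A i)) + (\<Sum>i. emeasure M2 (A i))"
        by (rule suminf_add[symmetric]) auto
      then show "(\<Sum>i. emeasure M1 (A i) + emeasure M2 (A i)) = emeasure M1 (\<Union> (range A)) + emeasure M2 (\<Union> (range A))"
        using A by (simp add: suminf_emeasure M1_def M2_def)
    qed
  qed (use that in \<open>auto simp: positive_def sets_M\<close>)
  \<comment> \<open>On an interval the two Stieltjes measures add up to its length because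
    \<open>u + v\<close> is the identity, and boxes determine Lebesgue measure.\<close>
  have M_lborel: "lborel = M"
  proof (rule lborel_eqI)
    fix l r :: real assume lr: "\<And>b. b \<in> Basis \<Longrightarrow> l \<bullet> b \<le> r \<bullet> b"
    then have lr: "l \<le> r" by simp
    have "emeasure M (box l r) = emeasure lborel {s. l < \<sigma> s \<and> \<sigma> s < r} + emeasure lborel {s. l < \<tau> s \<and> \<tau> s < r}"
      by (simp add: emeasure_M M1_def M2_def emeasure_distr vimage_def)
    also have "\<dots> = ennreal (u r - u l) + ennreal (v r - v l)" using \<sigma>(3)[OF lr] \<tau>(3)[OF lr] by simp
    also have "\<dots> = ennreal ((u r - u l) + (v r - v l))"
      using monoD[OF mono(1) lr] monoD[OF mono(2) lr] by (simp flip: ennreal_plus)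
    also have "(u r - u l) + (v r - v l) = r - l" using sum[of r] sum[of l] by linarith
    finally show "emeasure M (box l r) = ennreal (\<Prod>b\<in>Basis. (r - l) \<bullet> b)" by simp
  qed (rule sets_M)
  obtain N where N: "{t. \<not> P t} \<subseteq> N" "N \<in> null_sets lborel"
    using P by (auto simp: eventually_ae_filter)
  obtain N' where N': "{t. \<not> Q t} \<subseteq> N'" "N' \<in> null_sets lborel"
    using Q by (auto simp: eventually_ae_filter)
  have [measurable]: "N \<in> sets borel" "N' \<in> sets borel" using N(2) N'(2) by auto
  \<comment> \<open>\<open>?B\<close> contains every point where both conditions fail. If \<sigma> s
    lies in it, then s = u (\<sigma> s) lies in \<open>N\<close>, so the image measure under
    \<sigma> gives it mass 0; the same holds for \<tau> with \<open>N'\<close>.\<close>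
  let ?B = "{t. u t \<in> N \<and> v t \<in> N'}"
  have B[measurable]: "?B \<in> sets borel" by measurable
  have "emeasure M1 ?B = emeasure lborel {s. \<sigma> s \<in> ?B}"
    unfolding M1_def by (simp add: emeasure_distr vimage_def)
  also have "\<dots> \<le> emeasure lborel N"
    by (rule emeasure_mono) (use \<sigma>(2) in auto)
  finally have 1: "emeasure M1 ?B = 0" using N(2) by auto
  have "emeasure M2 ?B = emeasure lborel {s. \<tau> s \<in> ?B}"
    unfolding M2_def by (simp add: emeasure_distr vimage_def)
  also have "\<dots> \<le> emeasure lborel N'"
    by (rule emeasure_mono) (use \<tau>(2) in auto)
  finally have 2: "emeasure M2 ?B = 0" using N'(2) by auto
  have "emeasure lborel ?B = 0"
    unfolding M_lborel using emeasure_M[OF B] 1 2 by simp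
  then have "?B \<in> null_sets lborel" by (auto simp: null_sets_def)
  then have "AE t in lborel. t \<notin> ?B" by (rule AE_not_in)
  then show ?thesis by eventually_elim (use N(1) N'(1) in auto)
qed

text \<open>A bounded \<open>u\<close> or \<open>v\<close> has no right inverse on the whole line.
  Keeping both unchanged on [-n, n] and continuing them outside with slope 1/2 preserves the sum and
  makes both surjective; the intervals exhaust the line.\<close>

lemma AE_complementary_mono:
  fixes u v :: "real \<Rightarrow> real"
  assumes mono: "mono u" "mono v" and sum: "\<And>t. u t + v t = t"
    and P: "AE t in lborel. P t" and Q: "AE t in lborel. Q t"
  shows "AE t in lborel. P (u t) \<or> Q (v t)"
proof -
  have local: "AE t in lborel. \<bar>t\<bar> \<le> real n \<longrightarrow> P (u t) \<or> Q (v t)" for n :: nat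
  proof -
    define c where "c t = max (- real n) (min (real n) t)" for t
    define u' where "u' t = u (c t) + (t - c t) / 2" for t
    define v' where "v' t = v (c t) + (t - c t) / 2" for t
    have c: "s \<le> t \<Longrightarrow> c s \<le> c t" "s \<le> t \<Longrightarrow> s - c s \<le> t - c t" "- real n \<le> c t" "c t \<le> real n" for s t
      unfolding c_def by auto
    have mono': "mono u'" "mono v'"
      unfolding u'_def v'_def using c(1,2) monoD[OF mono(1)] monoD[OF mono(2)]
      by (auto intro!: monoI add_mono divide_right_mono)
    have sum': "u' t + v' t = t" for t
      using sum[of "c t"] by (simp add: u'_def v'_def field_simps)
    have cont': "continuous_on UNIV u'" "continuous_on UNIV v'"
      using complementary_mono_lipschitz[OF mono' sum'] complementary_mono_lipschitz[OF mono'(2,1)] sum'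
      by (auto intro!: lipschitz_on_continuous_on[of 1] lipschitz_onI simp: dist_real_def add.commute)
    have surj: "surj w'" if w: "mono w" and w'_def: "\<And>t. w' t = w (c t) + (t - c t) / 2"
        and cont: "continuous_on UNIV w'" for w w' :: "real \<Rightarrow> real"
    proof (rule surjI)
      fix y
      \<comment> \<open>Slope 1/2 over a length \<open>2 * a\<close> moves the boundary value by
        \<open>a\<close>, which is large enough to pass \<open>y\<close> in either direction; the
        intermediate value theorem does the rest.\<close>
      define a where "a = \<bar>y\<bar> + \<bar>w (real n)\<bar> + \<bar>w (- real n)\<bar>"
      have a: "a \<ge> 0" by (simp add: a_def)
      have "c (- real n - 2 * a) = - real n" "c (real n + 2 * a) = real n" using a by (auto simp: c_def)
      then have "w' (- real n - 2 * a) = w (- real n) - a" "w' (real n + 2 * a) = w (real n) + a"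
        unfolding w'_def by simp_all
      then have "w' (- real n - 2 * a) \<le> y" "y \<le> w' (real n + 2 * a)"
        unfolding a_def by linarith+
      moreover have "- real n - 2 * a \<le> real n + 2 * a" using a by simp
      ultimately have "\<exists>x. w' x = y"
        using IVT'[of w' "- real n - 2 * a" y "real n + 2 * a"] continuous_on_subset[OF cont] by blast
      then show "w' (SOME x. w' x = y) = y" by (rule someI_ex)
    qed
    have "surj u'" "surj v'"
      using surj[OF mono(1) _ cont'(1)] surj[OF mono(2) _ cont'(2)] by (auto simp: u'_def v'_def)
    from AE_complementary_mono_surj[OF mono' sum' this P Q] show ?thesis
    proof eventually_elim
      case (elim t)
      show ?case
      proof
        assume "\<bar>t\<bar> \<le> real n"
        then have "c t = t" by (auto simp: c_def)
        then show "P (u t) \<or> Q (v t)" using elim by (simp add: u'_def v'_def)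
      qed
    qed
  qed
  have "AE t in lborel. \<forall>n::nat. \<bar>t\<bar> \<le> real n \<longrightarrow> P (u t) \<or> Q (v t)"
    using local by (subst AE_all_countable) blast
  then show ?thesis
    by eventually_elim (use real_arch_simple in blast)
qed

section \<open>Primitives of decreasing functions\<close>

definition primitive :: "(real \<Rightarrow> 'e::ordered_banach) \<Rightarrow> (real \<Rightarrow> 'e) \<Rightarrow> bool" where
  "primitive F P \<longleftrightarrow> (\<forall>s t. s \<le> t \<longrightarrow>
     (t - s) *\<^sub>R F t \<le> P t - P s \<and> P t - P s \<le> (t - s) *\<^sub>R F s)"

lemma primitiveD:
  assumes "primitive F P" "s \<le> t"
  shows "(t - s) *\<^sub>R F t \<le> P t - P s" "P t - P s \<le> (t - s) *\<^sub>R F s"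
  using assms by (auto simp: primitive_def)

lemma primitive_mono:
  assumes P: "primitive F P" and Q: "primitive G Q" and FG: "\<And>t. F t \<le> G t" and st: "s \<le> t"
  shows "P t - P s \<le> Q t - Q s"
proof -
  have "(P t - P s) - (Q t - Q s) \<le> (1 / real (Suc n)) *\<^sub>R ((t - s) *\<^sub>R (G s - G t))" for n
  proof -
    define h where "h = (t - s) / real (Suc n)"
    define r where "r i = s + real i * h" for i
    have h: "h \<ge> 0" using st by (simp add: h_def)
    have "real (Suc n) * h = t - s" by (simp add: h_def)
    then have r: "r 0 = s" "r (Suc n) = t" "r (Suc i) - r i = h" "r i \<le> r (Suc i)" for i
      using h by (simp_all add: r_def algebra_simps)
    \<comment> \<open>Per cell, \<open>P\<close> grows by at most \<open>h\<close> times
      \<open>G\<close> at the left end and \<open>Q\<close> by at least \<open>h\<close> times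
      \<open>G\<close> at the right end. The losses telescope to one difference of \<open>G\<close>,
      scaled by the mesh.\<close>
    have "(P (r k) - P (r 0)) - (Q (r k) - Q (r 0)) \<le> h *\<^sub>R (G (r 0) - G (r k))" for k
    proof (induction k)
      case (Suc k)
      have "P (r (Suc k)) - P (r k) \<le> h *\<^sub>R F (r k)" using primitiveD(2)[OF P r(4)[of k]] r(3) by simp
      also have "\<dots> \<le> h *\<^sub>R G (r k)" using FG h by (intro scaleR_left_mono)
      finally have 1: "P (r (Suc k)) - P (r k) \<le> h *\<^sub>R G (r k)" .
      have 2: "h *\<^sub>R G (r (Suc k)) \<le> Q (r (Suc k)) - Q (r k)" using primitiveD(1)[OF Q r(4)[of k]] r(3) by simp
      have "((P (r (Suc k)) - P (r 0)) - (Q (r (Suc k)) - Q (r 0))) =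
          ((P (r k) - P (r 0)) - (Q (r k) - Q (r 0))) + ((P (r (Suc k)) - P (r k)) - (Q (r (Suc k)) - Q (r k)))"
        by (simp add: algebra_simps)
      also have "\<dots> \<le> h *\<^sub>R (G (r 0) - G (r k)) + (h *\<^sub>R G (r k) - h *\<^sub>R G (r (Suc k)))"
        by (intro add_mono diff_mono Suc 1 2)
      also have "\<dots> = h *\<^sub>R (G (r 0) - G (r (Suc k)))" by (simp add: scaleR_diff_right)
      finally show ?case .
    qed simp
    from this[of "Suc n"] show ?thesis unfolding r by (simp add: h_def)
  qed
  then have "(P t - P s) - (Q t - Q s) \<le> 0" by (rule ordered_banach_archimedean)
  then show ?thesis by simp
qed

text \<open>\<open>F a\<close> itself may exceed \<open>h\<close>, but it only counts on an initial
  piece whose length \<open>d\<close> tends to 0. This is the form needed for sums, where the level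
  function of the sum dominates \<open>F\<close> only strictly to the right of
  \<open>u t\<close>.\<close>

lemma primitive_upper:
  assumes P: "primitive F P" and h: "\<And>r. a < r \<Longrightarrow> F r \<le> h" and ab: "a \<le> b"
  shows "P b - P a \<le> (b - a) *\<^sub>R h"
proof -
  have "(P b - P a) - (b - a) *\<^sub>R h \<le> (1 / real (Suc n)) *\<^sub>R ((b - a) *\<^sub>R (F a - h))" for n
  proof (cases "a = b")
    case False
    define d where "d = (b - a) / real (Suc n)"
    have "(b - a) / real (Suc n) \<le> (b - a) / 1" using ab by (intro divide_left_mono) auto
    then have d: "0 < d" "a + d \<le> b" using ab False by (simp_all add: d_def)
    have "P b - P a = (P b - P (a + d)) + (P (a + d) - P a)" by simp
    also have "\<dots> \<le> (b - (a + d)) *\<^sub>R F (a + d) + ((a + d) - a) *\<^sub>R F a"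
      using d by (intro add_mono primitiveD[OF P]) auto
    also have "\<dots> \<le> (b - (a + d)) *\<^sub>R h + d *\<^sub>R F a"
      using d h by (intro add_mono scaleR_left_mono) auto
    also have "\<dots> = (b - a) *\<^sub>R h + d *\<^sub>R (F a - h)" by (simp add: algebra_simps)
    finally have "P b - P a \<le> (b - a) *\<^sub>R h + d *\<^sub>R (F a - h)" .
    moreover have "(1 / real (Suc n)) *\<^sub>R ((b - a) *\<^sub>R (F a - h)) = d *\<^sub>R (F a - h)"
      by (simp add: d_def)
    ultimately show ?thesis by (simp only: diff_le_eq add.commute)
  qed simp
  then have "(P b - P a) - (b - a) *\<^sub>R h \<le> 0" by (rule ordered_banach_archimedean)
  then show ?thesis by simp
qed

lemma primitive_lipschitz:
  assumes P: "primitive F P" and F: "\<And>t. 0 \<le> F t" "\<And>t. F t \<le> m"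
  shows "norm (P t - P s) \<le> \<bar>t - s\<bar> * norm m"
proof -
  have *: "norm (P t - P s) \<le> (t - s) * norm m" if "s \<le> t" for s t
  proof -
    have "0 \<le> (t - s) *\<^sub>R F t" using F that by (intro scaleR_nonneg_nonneg) auto
    also have "\<dots> \<le> P t - P s" by (rule primitiveD[OF P that])
    finally have 0: "0 \<le> P t - P s" .
    have "P t - P s \<le> (t - s) *\<^sub>R F s" by (rule primitiveD[OF P that])
    also have "\<dots> \<le> (t - s) *\<^sub>R m" using F that by (intro scaleR_left_mono) auto
    finally have "norm (P t - P s) \<le> norm ((t - s) *\<^sub>R m)" using 0 by (intro norm_mono_cone)
    then show ?thesis using that by simp
  qed
  show ?thesis
  proof (cases "s \<le> t")
    case False
    then show ?thesis using *[of t s] by (simp add: norm_minus_commute)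
  qed (use * in auto)
qed

text \<open>For unbounded \<open>u\<close> this is composition of limits. If \<open>u\<close> has a
  finite supremum \<open>U\<close>, then \<open>F\<close> vanishes beyond \<open>U\<close>, so
  \<open>P\<close> already equals \<open>J\<close> there, and the Lipschitz bound carries this value
  back to the limit of \<open>P (u t)\<close>.\<close>

lemma primitive_comp_tendsto:
  fixes P :: "real \<Rightarrow> 'e::ordered_banach"
  assumes P: "primitive F P" and F: "\<And>t. 0 \<le> F t" "\<And>t. F t \<le> m"
    and lim: "(P \<longlongrightarrow> J) at_top" and u: "mono (u :: real \<Rightarrow> real)"
    and zero: "\<And>s. (\<And>t. u t < s) \<Longrightarrow> F s = 0"
  shows "((\<lambda>t. P (u t)) \<longlongrightarrow> J) at_top"
proof (cases "\<forall>s. \<exists>t. s \<le> u t")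
  case True
  have "filterlim u at_top at_top"
    unfolding filterlim_at_top
  proof
    fix Z obtain t where "Z \<le> u t" using True by blast
    then show "\<forall>\<^sub>F x in at_top. Z \<le> u x"
      using monoD[OF u] unfolding eventually_at_top_linorder by (intro exI[of _ t]) (auto intro: order_trans)
  qed
  then show ?thesis by (rule filterlim_compose[OF lim])
next
  case False
  then obtain s0 where s0: "\<And>t. u t < s0" by (auto simp: not_le)
  have bdd: "bdd_above (range u)" using s0 by (intro bdd_aboveI[of _ s0]) (auto intro: less_imp_le)
  define U where "U = (SUP t. u t)"
  have uU: "u t \<le> U" for t unfolding U_def by (intro cSUP_upper bdd) auto
  have F0: "F s = 0" if "U < s" for s
    by (rule zero) (use uU that in \<open>auto intro: le_less_trans\<close>)
  have PJ: "P s = J" if s: "U < s" for s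
  proof -
    have "P t = P s" if "s \<le> t" for t
      using primitiveD[OF P that] F0[OF s] F0[of t] s that by (simp add: order_antisym)
    then have "\<forall>\<^sub>F t in at_top. P t = P s"
      unfolding eventually_at_top_linorder by blast
    then have "(P \<longlongrightarrow> P s) at_top" by (rule tendsto_eventually)
    then show ?thesis using lim tendsto_unique trivial_limit_at_top_linorder by blast
  qed
  have bound: "norm (P (u t) - J) \<le> (U - u t) * norm m" for t
  proof -
    \<comment> \<open>\<open>P s = J\<close> is available only for \<open>s > U\<close>, so the
      bound at \<open>U\<close> is reached from the right.\<close>
    have "((\<lambda>s. (s - u t) * norm m) \<longlongrightarrow> (U - u t) * norm m) (at_right U)"
      by (intro tendsto_intros)
    moreover have "\<forall>\<^sub>F s in at_right U. norm (P (u t) - J) \<le> (s - u t) * norm m"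
      using eventually_at_right_less[of U]
    proof eventually_elim
      case (elim s)
      then show ?case
        using primitive_lipschitz[OF P F, of s "u t"] PJ[OF elim] uU[of t]
        by (simp add: norm_minus_commute)
    qed
    ultimately show ?thesis by (rule tendsto_lowerbound) simp
  qed
  have "(u \<longlongrightarrow> U) at_top"
  proof (rule increasing_tendsto)
    show "\<forall>\<^sub>F n in at_top. u n \<le> U" using uU by simp
    fix x assume "x < U"
    then obtain t where "x < u t" unfolding U_def using less_cSUP_iff[OF _ bdd] by auto
    then show "\<forall>\<^sub>F n in at_top. x < u n"
      using monoD[OF u] unfolding eventually_at_top_linorder
      by (intro exI[of _ t]) (auto intro: less_le_trans)
  qed
  then have "((\<lambda>t. (U - u t) * norm m) \<longlongrightarrow> (U - U) * norm m) at_top"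
    by (intro tendsto_intros)
  then have "((\<lambda>t. (U - u t) * norm m) \<longlongrightarrow> 0) at_top" by simp
  then have "((\<lambda>t. P (u t) - J) \<longlongrightarrow> 0) at_top"
    by (rule tendsto_norm_zero_cancel[OF tendsto_sandwich[OF _ _ tendsto_const, rotated 2]])
      (use bound in auto)
  then show ?thesis by (simp add: LIM_zero_iff)
qed

text \<open>For a decreasing \<open>F\<close> with \<open>0 \<le> F \<le> m\<close> this is the value
  \<open>\<integral>\<^sub>0\<^sup>\<infinity> F + \<integral>\<^sub>-\<^sub>\<infinity>\<^sup>0 (F - m)\<close>, read off from a primitive normalised at \<open>-\<infinity>\<close>.\<close>

definition survival_integral :: "'e::ordered_banach \<Rightarrow> (real \<Rightarrow> 'e) \<Rightarrow> 'e \<Rightarrow> bool" where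
  "survival_integral m F J \<longleftrightarrow> (\<exists>P. primitive F P \<and> (P \<longlongrightarrow> J) at_top \<and>
     ((\<lambda>t. P t - t *\<^sub>R m) \<longlongrightarrow> 0) at_bot)"

lemma survival_integral_mono:
  assumes "survival_integral m F I" "survival_integral m G J" "\<And>t. F t \<le> G t"
  shows "I \<le> J"
proof -
  obtain P where P: "primitive F P" "(P \<longlongrightarrow> I) at_top" "((\<lambda>t. P t - t *\<^sub>R m) \<longlongrightarrow> 0) at_bot"
    using assms(1) by (auto simp: survival_integral_def)
  obtain Q where Q: "primitive G Q" "(Q \<longlongrightarrow> J) at_top" "((\<lambda>t. Q t - t *\<^sub>R m) \<longlongrightarrow> 0) at_bot"
    using assms(2) by (auto simp: survival_integral_def)
  have le: "P t - P s \<le> Q t - Q s" if "s \<le> t" for s t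
    by (rule primitive_mono[OF P(1) Q(1) assms(3) that])
  have "I - P s \<le> J - Q s" for s
  proof (rule ordered_banach_limit_le)
    show "((\<lambda>t. P t - P s) \<longlongrightarrow> I - P s) at_top" "((\<lambda>t. Q t - Q s) \<longlongrightarrow> J - Q s) at_top"
      by (intro tendsto_intros P Q)+
    show "\<forall>\<^sub>F t in at_top. P t - P s \<le> Q t - Q s"
      using eventually_ge_at_top[of s] by eventually_elim (rule le)
  qed simp
  \<comment> \<open>After \<open>t\<close> has gone to infinity, the same multiple of
    \<open>m\<close> is added on both sides; this produces exactly the two normalised expressions
    that vanish as \<open>s\<close> tends to minus infinity.\<close>
  then have le2: "I - (P s - s *\<^sub>R m) \<le> J - (Q s - s *\<^sub>R m)" for s
    by (simp add: algebra_simps)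
  have "I - 0 \<le> J - 0"
  proof (rule ordered_banach_limit_le)
    show "((\<lambda>s. I - (P s - s *\<^sub>R m)) \<longlongrightarrow> I - 0) at_bot" "((\<lambda>s. J - (Q s - s *\<^sub>R m)) \<longlongrightarrow> J - 0) at_bot"
      by (intro tendsto_intros P Q)+
  qed (use le2 in auto)
  then show ?thesis by simp
qed

lemma survival_integral_unique:
  assumes "survival_integral m F I" "survival_integral m F J"
  shows "I = J"
  using survival_integral_mono[OF assms] survival_integral_mono[OF assms(2,1)] by (auto intro: antisym)

text \<open>The hypotheses say how the level sets of a sum of two comonotonic functions sit
  between those of the summands.\<close>

lemma survival_integral_add:
  fixes F G H :: "real \<Rightarrow> 'e::ordered_banach"
  assumes u: "mono u" and v: "mono v" and sum: "\<And>t. u t + v t = t"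
    and F: "\<And>t. 0 \<le> F t" "\<And>t. F t \<le> m" and G: "\<And>t. 0 \<le> G t" "\<And>t. G t \<le> m"
    and HF: "\<And>t. H t \<le> F (u t)" and FH: "\<And>s t. u t < s \<Longrightarrow> F s \<le> H t"
    and HG: "\<And>t. H t \<le> G (v t)" and GH: "\<And>s t. v t < s \<Longrightarrow> G s \<le> H t"
    and F0: "\<And>s. (\<And>t. u t < s) \<Longrightarrow> F s = 0" and Fm: "\<And>s. (\<And>t. s < u t) \<Longrightarrow> F s = m"
    and G0: "\<And>s. (\<And>t. v t < s) \<Longrightarrow> G s = 0" and Gm: "\<And>s. (\<And>t. s < v t) \<Longrightarrow> G s = m"
    and I: "survival_integral m F I" and J: "survival_integral m G J"
  shows "survival_integral m H (I + J)"
proof -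
  obtain P where P: "primitive F P" "(P \<longlongrightarrow> I) at_top" "((\<lambda>t. P t - t *\<^sub>R m) \<longlongrightarrow> 0) at_bot"
    using I by (auto simp: survival_integral_def)
  obtain Q where Q: "primitive G Q" "(Q \<longlongrightarrow> J) at_top" "((\<lambda>t. Q t - t *\<^sub>R m) \<longlongrightarrow> 0) at_bot"
    using J by (auto simp: survival_integral_def)
  have part: "(w t - w s) *\<^sub>R H t \<le> R (w t) - R (w s)" "R (w t) - R (w s) \<le> (w t - w s) *\<^sub>R H s"
    if "s \<le> t" "mono w" "\<And>t. H t \<le> E (w t)" "\<And>s t. w t < s \<Longrightarrow> E s \<le> H t" "primitive E R"
    for s t w E R
  proof -
    have w: "w s \<le> w t" using that by (auto dest: monoD)
    have "(w t - w s) *\<^sub>R H t \<le> (w t - w s) *\<^sub>R E (w t)" using w that by (intro scaleR_left_mono) auto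
    also have "\<dots> \<le> R (w t) - R (w s)" by (rule primitiveD[OF that(5) w])
    finally show "(w t - w s) *\<^sub>R H t \<le> R (w t) - R (w s)" .
    show "R (w t) - R (w s) \<le> (w t - w s) *\<^sub>R H s"
      by (rule primitive_upper[OF that(5) that(4) w])
  qed
  have "primitive H (\<lambda>t. P (u t) + Q (v t))"
    unfolding primitive_def
  proof (intro allI impI)
    fix s t :: real assume st: "s \<le> t"
    have "t - s = (u t - u s) + (v t - v s)" using sum[of t] sum[of s] by linarith
    then have scale: "(t - s) *\<^sub>R x = (u t - u s) *\<^sub>R x + (v t - v s) *\<^sub>R x" for x :: 'e
      by (simp only: scaleR_left_distrib)
    have eq: "P (u t) + Q (v t) - (P (u s) + Q (v s)) = (P (u t) - P (u s)) + (Q (v t) - Q (v s))"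
      by simp
    show "(t - s) *\<^sub>R H t \<le> P (u t) + Q (v t) - (P (u s) + Q (v s)) \<and>
      P (u t) + Q (v t) - (P (u s) + Q (v s)) \<le> (t - s) *\<^sub>R H s"
      unfolding scale eq
      by (intro conjI add_mono part[OF st u HF FH P(1)] part[OF st v HG GH Q(1)])
  qed
  moreover have "((\<lambda>t. P (u t) + Q (v t)) \<longlongrightarrow> I + J) at_top"
    by (intro tendsto_add primitive_comp_tendsto[OF P(1) F P(2) u F0]
      primitive_comp_tendsto[OF Q(1) G Q(2) v G0])
  moreover have "((\<lambda>t. P (u t) + Q (v t) - t *\<^sub>R m) \<longlongrightarrow> 0) at_bot"
  proof -
    \<comment> \<open>The limit at minus infinity is the one at plus infinity for reflected data:
      \<open>m - E (- s)\<close> again decreases between 0 and \<open>m\<close>, has the primitive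
      \<open>R (- s) + s *\<^sub>R m\<close>, and this primitive tends to 0.\<close>
    have reflect: "((\<lambda>t. R (w t) - w t *\<^sub>R m) \<longlongrightarrow> 0) at_bot"
      if R: "primitive E R" and lim: "((\<lambda>t. R t - t *\<^sub>R m) \<longlongrightarrow> 0) at_bot" and w: "mono w"
        and E: "\<And>t. 0 \<le> E t" "\<And>t. E t \<le> m" and Em: "\<And>s. (\<And>t. s < w t) \<Longrightarrow> E s = m" for w :: "real \<Rightarrow> real" and E R
    proof -
      have "((\<lambda>t. (\<lambda>s. R (- s) + s *\<^sub>R m) (- w (- t))) \<longlongrightarrow> 0) at_top"
      proof (rule primitive_comp_tendsto[where F = "\<lambda>s. m - E (- s)" and m = m])
        show "primitive (\<lambda>s. m - E (- s)) (\<lambda>s. R (- s) + s *\<^sub>R m)"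
          unfolding primitive_def
        proof (intro allI impI)
          fix s t :: real assume "s \<le> t"
          then have "- t \<le> - s" by simp
          from primitiveD[OF R this]
          show "(t - s) *\<^sub>R (m - E (- t)) \<le> R (- t) + t *\<^sub>R m - (R (- s) + s *\<^sub>R m) \<and>
            R (- t) + t *\<^sub>R m - (R (- s) + s *\<^sub>R m) \<le> (t - s) *\<^sub>R (m - E (- s))"
            by (simp add: algebra_simps)
        qed
        show "((\<lambda>s. R (- s) + s *\<^sub>R m) \<longlongrightarrow> 0) at_top"
          using lim by (simp add: filterlim_at_bot_mirror)
        show "mono (\<lambda>t. - w (- t))" using w by (auto simp: mono_def)
        show "m - E (- s) = 0" if "\<And>t. - w (- t) < s" for s
        proof -
          have "- s < w t" for t using that[of "- t"] by simp
          then show ?thesis using Em[of "- s"] by simp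
        qed
      qed (use E in auto)
      then show ?thesis by (simp add: filterlim_at_bot_mirror)
    qed
    have "((\<lambda>t. (P (u t) - u t *\<^sub>R m) + (Q (v t) - v t *\<^sub>R m)) \<longlongrightarrow> 0 + 0) at_bot"
      by (intro tendsto_add reflect[OF P(1,3) u F Fm] reflect[OF Q(1,3) v G Gm])
    moreover have "(P (u t) - u t *\<^sub>R m) + (Q (v t) - v t *\<^sub>R m) = P (u t) + Q (v t) - t *\<^sub>R m" for t
      by (subst (3) sum[of t, symmetric]) (simp add: scaleR_left_distrib)
    ultimately show ?thesis by simp
  qed
  ultimately show ?thesis unfolding survival_integral_def by blast
qed

lemma survival_integral_scale:
  fixes F :: "real \<Rightarrow> 'e::ordered_banach"
  assumes I: "survival_integral m F I" and a: "a > 0"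
  shows "survival_integral m (\<lambda>t. F (t / a)) (a *\<^sub>R I)"
proof -
  obtain P where P: "primitive F P" "(P \<longlongrightarrow> I) at_top" "((\<lambda>t. P t - t *\<^sub>R m) \<longlongrightarrow> 0) at_bot"
    using I by (auto simp: survival_integral_def)
  have "primitive (\<lambda>t. F (t / a)) (\<lambda>t. a *\<^sub>R P (t / a))"
    unfolding primitive_def
  proof (intro allI impI)
    fix s t :: real assume "s \<le> t"
    then have "s / a \<le> t / a" using a by (simp add: divide_right_mono)
    note D = primitiveD[OF P(1) this]
    have eq: "a *\<^sub>R ((t / a - s / a) *\<^sub>R x) = (t - s) *\<^sub>R x" for x :: 'e
      using a by (simp add: right_diff_distrib)
    show "(t - s) *\<^sub>R F (t / a) \<le> a *\<^sub>R P (t / a) - a *\<^sub>R P (s / a) \<and>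
      a *\<^sub>R P (t / a) - a *\<^sub>R P (s / a) \<le> (t - s) *\<^sub>R F (s / a)"
      using scaleR_left_mono[OF D(1), of a] scaleR_left_mono[OF D(2), of a] a
      unfolding eq by (simp add: scaleR_diff_right)
  qed
  moreover have "((\<lambda>t. a *\<^sub>R P (t / a)) \<longlongrightarrow> a *\<^sub>R I) at_top"
  proof (intro tendsto_scaleR tendsto_const filterlim_compose[OF P(2)])
    show "LIM t at_top. t / a :> at_top" using a by real_asymp
  qed
  moreover have "((\<lambda>t. a *\<^sub>R P (t / a) - t *\<^sub>R m) \<longlongrightarrow> 0) at_bot"
  proof -
    have "LIM t at_bot. t / a :> at_bot" using a by real_asymp
    from filterlim_compose[OF P(3) this]
    have "((\<lambda>t. a *\<^sub>R (P (t / a) - (t / a) *\<^sub>R m)) \<longlongrightarrow> a *\<^sub>R 0) at_bot"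
      by (intro tendsto_scaleR tendsto_const)
    then show ?thesis using a by (simp add: scaleR_diff_right)
  qed
  ultimately show ?thesis unfolding survival_integral_def by blast
qed

lemma survival_integral_const:
  fixes m :: "'e::ordered_banach"
  assumes m: "0 \<le> m"
  shows "survival_integral m (\<lambda>t. if t \<le> c then m else 0) (c *\<^sub>R m)"
proof -
  have "primitive (\<lambda>t. if t \<le> c then m else 0) (\<lambda>t. min t c *\<^sub>R m)"
    unfolding primitive_def using m
    by (auto simp: min_def scaleR_right_mono scaleR_nonneg_nonneg simp flip: scaleR_left_diff_distrib)
  moreover have "\<forall>\<^sub>F t in at_top. min t c *\<^sub>R m = c *\<^sub>R m"
    using eventually_ge_at_top[of c] by eventually_elim (simp add: min_def)
  moreover have "\<forall>\<^sub>F t in at_bot. min t c *\<^sub>R m - t *\<^sub>R m = 0"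
    using eventually_le_at_bot[of c] by eventually_elim (simp add: min_def)
  ultimately show ?thesis
    unfolding survival_integral_def by (blast intro: tendsto_eventually)
qed

section \<open>Primitives and Bochner integrals\<close>

lemma nn_integral_lebesgue_on:
  assumes "K \<in> sets lebesgue"
  shows "(\<integral>\<^sup>+x. f x \<partial>lebesgue_on K) = (\<integral>\<^sup>+x. f x * indicator K x \<partial>lborel)"
  using assms by (simp add: nn_integral_restrict_space nn_integral_completion)

text \<open>Bochner integrability of both halves, put into a form that can be carried through
  \<open>u\<close> and \<open>v\<close>. The difference is written \<open>m - F t\<close> so that
  for \<open>F t \<le> m\<close> it lies in the cone and monotonicity of the norm applies.\<close>

definition survival_regular :: "'e::ordered_banach \<Rightarrow> (real \<Rightarrow> 'e) \<Rightarrow> bool" where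
  "survival_regular m F \<longleftrightarrow> (AE t in lborel. isCont F t) \<and>
     (\<integral>\<^sup>+t. ennreal (norm (F t)) * indicator {0..} t \<partial>lborel) < \<infinity> \<and>
     (\<integral>\<^sup>+t. ennreal (norm (m - F t)) * indicator {..0} t \<partial>lborel) < \<infinity>"

lemma bochner_integrable_survival_iff:
  fixes F :: "real \<Rightarrow> 'e::ordered_banach"
  assumes F: "antimono F"
  shows "bochner_integrable (lebesgue_on {0..}) F \<and> bochner_integrable (lebesgue_on {..0}) (\<lambda>t. F t - m) \<longleftrightarrow>
    survival_regular m F"
proof
  assume "bochner_integrable (lebesgue_on {0..}) F \<and> bochner_integrable (lebesgue_on {..0}) (\<lambda>t. F t - m)"
  then obtain I J where I: "has_bochner (lebesgue_on {0..}) F I"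
    and J: "has_bochner (lebesgue_on {..0}) (\<lambda>t. F t - m) J"
    by (auto simp: bochner_integrable_def)
  obtain C1 where C1: "countable C1" "AE t in lebesgue_on {0..}. F t \<in> closure C1"
    using strongly_measurable_separable[OF has_bochner_strongly_measurable[OF I]] by blast
  obtain C2 where C2: "countable C2" "AE t in lebesgue_on {..0}. F t - m \<in> closure C2"
    using strongly_measurable_separable[OF has_bochner_strongly_measurable[OF J]] by blast
  \<comment> \<open>On the left half-line it is \<open>F - m\<close> that has essentially separable
    range; translation by \<open>m\<close> turns this into one countable set for \<open>F\<close> on
    the whole line.\<close>
  let ?C = "C1 \<union> (+) m ` C2"
  have "AE t in lborel. F t \<in> closure ?C"
  proof (rule AE_lebesgue_on_Un)
    show "AE t in lebesgue_on {0..}. F t \<in> closure ?C"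
      using C1(2) by eventually_elim (simp add: closure_Un)
    show "AE t in lebesgue_on {..0}. F t \<in> closure ?C"
      using C2(2)
    proof eventually_elim
      case (elim t)
      then have "m + (F t - m) \<in> (+) m ` closure C2" by (rule imageI)
      then show ?case by (simp add: closure_Un closure_translation)
    qed
  qed auto
  then have "AE t in lborel. isCont F t"
    by (rule antimono_AE_isCont[OF F, rotated]) (use C1(1) C2(1) in auto)
  then show "survival_regular m F"
    unfolding survival_regular_def
    using has_bochner_norm_finite[OF I] has_bochner_norm_finite[OF J]
    by (simp add: nn_integral_lebesgue_on norm_minus_commute)
next
  assume reg: "survival_regular m F"
  then have ae: "AE t in lborel. isCont F t" by (simp add: survival_regular_def)
  then have ae': "AE t in lborel. isCont (\<lambda>t. F t - m) t"
    by eventually_elim (intro continuous_intros)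
  show "bochner_integrable (lebesgue_on {0..}) F \<and> bochner_integrable (lebesgue_on {..0}) (\<lambda>t. F t - m)"
    using reg unfolding survival_regular_def
    by (auto intro!: bochner_integrableI strongly_measurable_AE_isCont ae ae'
      simp: nn_integral_lebesgue_on norm_minus_commute)
qed

section \<open>From Bochner integrals to primitives\<close>

lemma bochner_integral_restrict_tendsto_0:
  fixes f :: "'a \<Rightarrow> 'b::banach"
  assumes f: "has_bochner M f I" and B: "\<And>n. B n \<in> sets M"
    and lim: "\<And>x. x \<in> space M \<Longrightarrow> \<forall>\<^sub>F n in sequentially. x \<notin> B n"
  shows "(\<lambda>n. bochner_integral M (\<lambda>x. indicator (B n) x *\<^sub>R f x)) \<longlonglongrightarrow> 0"
proof -
  obtain \<phi> :: "'a \<Rightarrow> real" where \<phi>[measurable]: "\<phi> \<in> borel_measurable M" and \<phi>_eq: "AE x in M. norm (f x) = \<phi> x"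
    using strongly_measurable_norm[OF has_bochner_strongly_measurable[OF f]] by blast
  note [measurable] = B
  let ?I = "\<lambda>n. bochner_integral M (\<lambda>x. indicator (B n) x *\<^sub>R f x)"
  \<comment> \<open>Scalar dominated convergence for the norm suffices, since the norm of a Bochner
    integral is at most the integral of the norm.\<close>
  have "(\<lambda>n. \<integral>\<^sup>+x. ennreal (\<phi> x) * indicator (B n) x \<partial>M) \<longlonglongrightarrow> (\<integral>\<^sup>+x. 0 \<partial>M)"
  proof (rule nn_integral_dominated_convergence[where w = "\<lambda>x. ennreal (\<phi> x)"])
    have "(\<integral>\<^sup>+x. ennreal (\<phi> x) \<partial>M) = (\<integral>\<^sup>+x. norm (f x) \<partial>M)"
      using \<phi>_eq by (intro nn_integral_cong_AE) auto
    then show "(\<integral>\<^sup>+x. ennreal (\<phi> x) \<partial>M) < \<infinity>" using has_bochner_norm_finite[OF f] by simp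
    show "AE x in M. (\<lambda>n. ennreal (\<phi> x) * indicator (B n) x) \<longlonglongrightarrow> 0"
    proof (rule AE_I2)
      fix x assume "x \<in> space M"
      from lim[OF this] have "\<forall>\<^sub>F n in sequentially. ennreal (\<phi> x) * indicator (B n) x = 0"
        by eventually_elim simp
      then show "(\<lambda>n. ennreal (\<phi> x) * indicator (B n) x) \<longlonglongrightarrow> 0"
        by (rule tendsto_eventually)
    qed
  qed (auto split: split_indicator)
  then have lim0: "(\<lambda>n. \<integral>\<^sup>+x. ennreal (\<phi> x) * indicator (B n) x \<partial>M) \<longlonglongrightarrow> 0" by simp
  have "ennreal (norm (?I n)) \<le> (\<integral>\<^sup>+x. ennreal (\<phi> x) * indicator (B n) x \<partial>M)" for n
  proof -
    have "ennreal (norm (?I n)) \<le> (\<integral>\<^sup>+x. norm (indicator (B n) x *\<^sub>R f x) \<partial>M)"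
      by (rule has_bochner_norm_le[OF has_bochner_bochner_integral[OF bochner_integrable_restrict[OF f B]]])
    also have "\<dots> = (\<integral>\<^sup>+x. ennreal (\<phi> x) * indicator (B n) x \<partial>M)"
      using \<phi>_eq by (intro nn_integral_cong_AE) (auto simp: indicator_def)
    finally show ?thesis .
  qed
  then have "(\<lambda>n. ennreal (norm (?I n))) \<longlonglongrightarrow> 0"
    by (intro tendsto_sandwich[OF always_eventually[OF allI[OF zero_le]] always_eventually[OF allI] tendsto_const lim0])
  then have "(\<lambda>n. norm (?I n)) \<longlonglongrightarrow> 0"
    by (subst (asm) ennreal_0[symmetric], subst (asm) tendsto_ennreal_iff) simp_all
  then show ?thesis by (rule tendsto_norm_zero_cancel)
qed

lemma bochner_integral_restrict_Diff:
  fixes f :: "'a \<Rightarrow> 'b::banach"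
  assumes f: "has_bochner M f I" and AB: "A \<in> sets M" "B \<in> sets M" "A \<subseteq> B"
  shows "bochner_integral M (\<lambda>x. indicator B x *\<^sub>R f x) - bochner_integral M (\<lambda>x. indicator A x *\<^sub>R f x) =
    bochner_integral M (\<lambda>x. indicator (B - A) x *\<^sub>R f x)"
proof -
  note h = has_bochner_bochner_integral[OF bochner_integrable_restrict[OF f]]
  have "indicator B x *\<^sub>R f x - indicator A x *\<^sub>R f x = indicator (B - A) x *\<^sub>R f x" for x
    using AB(3) by (auto simp: indicator_def)
  then show ?thesis
    using bochner_integral_eq[OF has_bochner_diff[OF h[OF AB(2)] h[OF AB(1)]]] by simp
qed

text \<open>The two integrands may differ outside \<open>space M\<close>, so they cannot be
  rewritten into each other. Monotonicity compares values on the space only; used in both directions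
  it gives equality.\<close>

lemma bochner_integral_restrict_space:
  fixes f :: "'a \<Rightarrow> 'b::ordered_banach"
  assumes f: "has_bochner M f I"
  shows "bochner_integral M (\<lambda>x. indicator (space M) x *\<^sub>R f x) = I"
proof (rule antisym)
  note h = has_bochner_bochner_integral[OF bochner_integrable_restrict[OF f sets.top]]
  show "bochner_integral M (\<lambda>x. indicator (space M) x *\<^sub>R f x) \<le> I"
    by (rule has_bochner_mono[OF h f]) simp
  show "I \<le> bochner_integral M (\<lambda>x. indicator (space M) x *\<^sub>R f x)"
    by (rule has_bochner_mono[OF f h]) simp
qed

text \<open>\<open>D\<close> stays abstract because differences of tails are \<open>{s..<t}\<close>
  on the right half-line and \<open>{s<..t}\<close> on the left one.\<close>

lemma bochner_integral_interval_bounds: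
  fixes f :: "real \<Rightarrow> 'b::ordered_banach"
  assumes f: "has_bochner (lebesgue_on K) f I" and anti: "antimono f" and st: "s \<le> t"
    and K: "K \<in> sets lebesgue" and D: "D \<in> sets borel" "D \<subseteq> K" "D \<subseteq> {s..t}" "emeasure lborel D = ennreal (t - s)"
  shows "(t - s) *\<^sub>R f t \<le> bochner_integral (lebesgue_on K) (\<lambda>x. indicator D x *\<^sub>R f x)"
    and "bochner_integral (lebesgue_on K) (\<lambda>x. indicator D x *\<^sub>R f x) \<le> (t - s) *\<^sub>R f s"
proof -
  have sets: "D \<in> sets (lebesgue_on K)"
    using K D by (simp add: sets_restrict_space_iff)
  have em: "emeasure (lebesgue_on K) D = ennreal (t - s)"
    using K D by (simp add: emeasure_restrict_space)
  then have me: "measure (lebesgue_on K) D = t - s" using st by (simp add: measure_def)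
  note h = has_bochner_bochner_integral[OF bochner_integrable_restrict[OF f sets]]
  have c: "has_bochner (lebesgue_on K) (\<lambda>x. indicator D x *\<^sub>R c) ((t - s) *\<^sub>R c)" for c :: 'b
    using has_bochner_const[OF sets, of c] em me by simp
  show "(t - s) *\<^sub>R f t \<le> bochner_integral (lebesgue_on K) (\<lambda>x. indicator D x *\<^sub>R f x)"
    by (rule has_bochner_mono[OF c h]) (use D(3) in \<open>auto simp: indicator_def intro!: antimonoD[OF anti]\<close>)
  show "bochner_integral (lebesgue_on K) (\<lambda>x. indicator D x *\<^sub>R f x) \<le> (t - s) *\<^sub>R f s"
    by (rule has_bochner_mono[OF h c]) (use D(3) in \<open>auto simp: indicator_def intro!: antimonoD[OF anti]\<close>)
qed

lemma survival_integral_bochner: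
  fixes F :: "real \<Rightarrow> 'e::ordered_banach"
  assumes F: "antimono F"
    and I: "has_bochner (lebesgue_on {0..}) F I" and J: "has_bochner (lebesgue_on {..0}) (\<lambda>t. F t - m) J"
  shows "survival_integral m F (I + J)"
proof -
  define T where "T t = bochner_integral (lebesgue_on {0..}) (\<lambda>x. indicator {t..} x *\<^sub>R F x)" for t :: real
  define B where "B t = bochner_integral (lebesgue_on {..0}) (\<lambda>x. indicator {..t} x *\<^sub>R (F x - m))" for t :: real
  \<comment> \<open>To the right of 0 the primitive is the total minus the remaining tail, to the
    left it is the line \<open>t *\<^sub>R m\<close> corrected by the tail of \<open>F - m\<close>.
    Both expressions give \<open>J\<close> at 0.\<close>
  define P where "P t = (if 0 \<le> t then I + J - T t else t *\<^sub>R m + B t)" for t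
  have anti': "antimono (\<lambda>t. F t - m)" using F by (auto simp: antimono_def)
  have sets1: "{t..} \<in> sets (lebesgue_on {0..})" if "0 \<le> t" for t :: real
    using that by (auto simp: sets_restrict_space_iff)
  have sets2: "{..t} \<in> sets (lebesgue_on {..0})" if "t \<le> 0" for t :: real
    using that by (auto simp: sets_restrict_space_iff)
  have T_0: "T 0 = I"
    using bochner_integral_restrict_space[OF I] by (simp add: T_def)
  have B_0: "B 0 = J"
    using bochner_integral_restrict_space[OF J] by (simp add: B_def)
  have P_nonpos: "P t = t *\<^sub>R m + B t" if "t \<le> 0" for t
    using that T_0 B_0 by (auto simp: P_def)
  have pos: "(t - s) *\<^sub>R F t \<le> P t - P s" "P t - P s \<le> (t - s) *\<^sub>R F s" if "0 \<le> s" "s \<le> t" for s t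
  proof -
    have "{s..} - {t..} = {s..<t}" using that by auto
    then have "P t - P s = bochner_integral (lebesgue_on {0..}) (\<lambda>x. indicator {s..<t} x *\<^sub>R F x)"
      using bochner_integral_restrict_Diff[OF I sets1[of t] sets1[of s]] that
      by (simp add: P_def T_def)
    moreover have "{s..<t} \<subseteq> {0..}" "{s..<t} \<subseteq> {s..t}" using that by auto
    ultimately show "(t - s) *\<^sub>R F t \<le> P t - P s" "P t - P s \<le> (t - s) *\<^sub>R F s"
      using bochner_integral_interval_bounds[OF I F that(2), of "{s..<t}"] that(2) by auto
  qed
  have neg: "(t - s) *\<^sub>R F t \<le> P t - P s" "P t - P s \<le> (t - s) *\<^sub>R F s" if "s \<le> t" "t \<le> 0" for s t
  proof -
    let ?B = "bochner_integral (lebesgue_on {..0}) (\<lambda>x. indicator {s<..t} x *\<^sub>R (F x - m))"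
    have "{..t} - {..s} = {s<..t}" using that by auto
    then have "B t - B s = ?B"
      using bochner_integral_restrict_Diff[OF J sets2[of s] sets2[of t]] that
      by (simp add: B_def)
    then have *: "P t - P s = (t - s) *\<^sub>R m + ?B"
      using that by (simp add: P_nonpos algebra_simps)
    have "{s<..t} \<subseteq> {..0}" "{s<..t} \<subseteq> {s..t}" using that by auto
    then have "(t - s) *\<^sub>R (F t - m) \<le> ?B" "?B \<le> (t - s) *\<^sub>R (F s - m)"
      using bochner_integral_interval_bounds[OF J anti' that(1), of "{s<..t}"] that(1) by auto
    then show "(t - s) *\<^sub>R F t \<le> P t - P s" "P t - P s \<le> (t - s) *\<^sub>R F s"
      unfolding * by (simp_all add: scaleR_diff_right le_diff_eq diff_le_eq add.commute)
  qed
  have "primitive F P"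
    unfolding primitive_def
  proof (intro allI impI)
    fix s t :: real assume st: "s \<le> t"
    consider "0 \<le> s" | "t \<le> 0" | "s < 0" "0 < t" by linarith
    then show "(t - s) *\<^sub>R F t \<le> P t - P s \<and> P t - P s \<le> (t - s) *\<^sub>R F s"
    proof cases
      case 3
      have eq: "P t - P s = (P t - P 0) + (P 0 - P s)" by simp
      have split: "(t - s) *\<^sub>R x = (t - 0) *\<^sub>R x + (0 - s) *\<^sub>R x" for x :: 'e
        by (simp add: scaleR_left_diff_distrib)
      have "(t - 0) *\<^sub>R F t + (0 - s) *\<^sub>R F t \<le> (t - 0) *\<^sub>R F t + (0 - s) *\<^sub>R F 0"
        using 3 antimonoD[OF F, of 0 t] by (intro add_left_mono scaleR_left_mono) auto
      also have "\<dots> \<le> (P t - P 0) + (P 0 - P s)"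
        using 3 by (intro add_mono pos neg) auto
      finally have lower: "(t - s) *\<^sub>R F t \<le> P t - P s" unfolding split[symmetric] eq[symmetric] .
      have "(P t - P 0) + (P 0 - P s) \<le> (t - 0) *\<^sub>R F 0 + (0 - s) *\<^sub>R F s"
        using 3 by (intro add_mono pos neg) auto
      also have "\<dots> \<le> (t - 0) *\<^sub>R F s + (0 - s) *\<^sub>R F s"
        using 3 antimonoD[OF F, of s 0] by (intro add_right_mono scaleR_left_mono) auto
      finally have "P t - P s \<le> (t - s) *\<^sub>R F s" unfolding split[symmetric] eq[symmetric] .
      with lower show ?thesis by blast
    qed (use st pos neg in auto)
  qed
  moreover have "(P \<longlongrightarrow> I + J) at_top"
  proof (rule tendsto_at_topI_sequentially)
    fix X :: "nat \<Rightarrow> real" assume X: "filterlim X at_top sequentially"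
    \<comment> \<open>Clipping keeps the tail inside the half-line for every \<open>n\<close>;
      eventually it changes nothing.\<close>
    have "(\<lambda>n. T (max 0 (X n))) \<longlonglongrightarrow> 0"
      unfolding T_def
    proof (rule bochner_integral_restrict_tendsto_0[OF I])
      show "\<forall>\<^sub>F n in sequentially. x \<notin> {max 0 (X n)..}" for x
        using filterlim_at_top_dense[THEN iffD1, OF X, rule_format, of x] by eventually_elim auto
    qed (rule sets1, simp)
    then have "(\<lambda>n. I + J - T (max 0 (X n))) \<longlonglongrightarrow> I + J - 0" by (intro tendsto_intros)
    moreover have "\<forall>\<^sub>F n in sequentially. I + J - T (max 0 (X n)) = P (X n)"
      using filterlim_at_top[THEN iffD1, OF X, rule_format, of 0]
      by eventually_elim (simp add: P_def)
    ultimately show "(\<lambda>n. P (X n)) \<longlonglongrightarrow> I + J"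
      by (simp add: Lim_transform_eventually)
  qed
  moreover have "((\<lambda>t. P t - t *\<^sub>R m) \<longlongrightarrow> 0) at_bot"
    unfolding filterlim_at_bot_mirror
  proof (rule tendsto_at_topI_sequentially)
    fix X :: "nat \<Rightarrow> real" assume X: "filterlim X at_top sequentially"
    have "(\<lambda>n. B (min 0 (- X n))) \<longlonglongrightarrow> 0"
      unfolding B_def
    proof (rule bochner_integral_restrict_tendsto_0[OF J])
      show "\<forall>\<^sub>F n in sequentially. x \<notin> {..min 0 (- X n)}" for x
        using filterlim_at_top_dense[THEN iffD1, OF X, rule_format, of "- x"] by eventually_elim auto
    qed (rule sets2, simp)
    moreover have "\<forall>\<^sub>F n in sequentially. B (min 0 (- X n)) = P (- X n) - (- X n) *\<^sub>R m"
      using filterlim_at_top[THEN iffD1, OF X, rule_format, of 0]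
      by eventually_elim (simp add: P_nonpos)
    ultimately show "(\<lambda>n. P (- X n) - (- X n) *\<^sub>R m) \<longlonglongrightarrow> 0"
      by (rule Lim_transform_eventually)
  qed
  ultimately show ?thesis unfolding survival_integral_def by blast
qed

lemma survival_integral_bochner_integral:
  fixes F :: "real \<Rightarrow> 'e::ordered_banach"
  assumes "antimono F" "survival_regular m F"
  shows "survival_integral m F (bochner_integral (lebesgue_on {0..}) F +
    bochner_integral (lebesgue_on {..0}) (\<lambda>t. F t - m))"
proof (rule survival_integral_bochner[OF assms(1)])
  show "has_bochner (lebesgue_on {0..}) F (bochner_integral (lebesgue_on {0..}) F)"
    "has_bochner (lebesgue_on {..0}) (\<lambda>t. F t - m) (bochner_integral (lebesgue_on {..0}) (\<lambda>t. F t - m))"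
    using bochner_integrable_survival_iff[OF assms(1), of m] assms(2)
    by (auto intro!: has_bochner_bochner_integral)
qed

section \<open>Regular level functions\<close>

text \<open>Monotonicity of the norm on the cone makes both scalar functions monotone, hence
  Borel.\<close>

lemma survival_regular_measurable:
  fixes F :: "real \<Rightarrow> 'e::ordered_banach"
  assumes F: "antimono F" and bounds: "\<And>t. 0 \<le> F t" "\<And>t. F t \<le> m"
  shows "(\<lambda>t. norm (F t)) \<in> borel_measurable borel" "(\<lambda>t. norm (m - F t)) \<in> borel_measurable borel"
proof -
  have "mono (\<lambda>t. - norm (F t))"
    using antimonoD[OF F] bounds by (intro monoI) (simp add: norm_mono_cone)
  from borel_measurable_uminus[OF borel_measurable_mono[OF this]]
  show "(\<lambda>t. norm (F t)) \<in> borel_measurable borel" by simp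
  have "mono (\<lambda>t. norm (m - F t))"
    using antimonoD[OF F] bounds by (intro monoI norm_mono_cone) (simp_all add: diff_left_mono)
  then show "(\<lambda>t. norm (m - F t)) \<in> borel_measurable borel" by (rule borel_measurable_mono)
qed

lemma AE_lborel_scale:
  assumes P: "AE t in lborel. P t" and a: "a \<noteq> (0::real)"
  shows "AE t in lborel. P (t / a)"
proof -
  obtain N where N: "{t. \<not> P t} \<subseteq> N" "N \<in> null_sets lborel"
    using P by (auto simp: eventually_ae_filter)
  have [measurable]: "N \<in> sets borel" using N(2) by auto
  have "AE t in lborel. 0 + (1 / a) * t \<notin> N"
    using a AE_not_in[OF N(2)] by (intro AE_borel_affine) auto
  then show ?thesis by eventually_elim (use N(1) in auto)
qed

text \<open>Besides positive homogeneity, this supplies the integrable majorants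
  \<open>F (t / 2)\<close> and \<open>m - F (t / 4)\<close> for sums.\<close>

lemma survival_regular_scale:
  fixes F :: "real \<Rightarrow> 'e::ordered_banach"
  assumes F: "antimono F" "\<And>t. 0 \<le> F t" "\<And>t. F t \<le> m" and reg: "survival_regular m F" and a: "a > 0"
  shows "survival_regular m (\<lambda>t. F (t / a))"
proof -
  note [measurable] = survival_regular_measurable[OF F]
  have ae: "AE t in lborel. isCont (\<lambda>t. F (t / a)) t"
    using AE_lborel_scale[of "isCont F" a] reg a
    unfolding survival_regular_def
    by (auto elim!: eventually_mono intro!: isCont_o2[of _ "\<lambda>t. t / a" F] continuous_intros)
  have nn: "(\<integral>\<^sup>+t. ennreal (g (t / a)) * indicator K t \<partial>lborel) = ennreal a * (\<integral>\<^sup>+t. ennreal (g t) * indicator K t \<partial>lborel)"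
    if [measurable]: "g \<in> borel_measurable borel" "K \<in> sets borel" and K: "\<And>t. a * t \<in> K \<longleftrightarrow> t \<in> K" for g K
    using nn_integral_real_affine[of "\<lambda>t. ennreal (g (t / a)) * indicator K t" a 0] a K
    by (simp add: indicator_def)
  have "(\<integral>\<^sup>+t. ennreal (norm (F (t / a))) * indicator {0..} t \<partial>lborel) =
    ennreal a * (\<integral>\<^sup>+t. ennreal (norm (F t)) * indicator {0..} t \<partial>lborel)"
    using a by (intro nn) (auto simp: zero_le_mult_iff)
  moreover have "(\<integral>\<^sup>+t. ennreal (norm (m - F (t / a))) * indicator {..0} t \<partial>lborel) =
    ennreal a * (\<integral>\<^sup>+t. ennreal (norm (m - F t)) * indicator {..0} t \<partial>lborel)"
    using a by (intro nn[of "\<lambda>t. norm (m - F t)"]) (auto simp: mult_le_0_iff)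
  ultimately show ?thesis
    using reg ae unfolding survival_regular_def by (simp add: ennreal_mult_less_top)
qed

lemma survival_regular_const:
  fixes m :: "'e::ordered_banach"
  shows "survival_regular m (\<lambda>t. if t \<le> c then m else 0)"
proof -
  have "AE t in lborel. t \<noteq> c" by (rule AE_lborel_singleton)
  then have "AE t in lborel. isCont (\<lambda>t. if t \<le> c then m else 0) t"
  proof eventually_elim
    case (elim t)
    show ?case
    proof (cases "t < c")
      case True
      then have "\<forall>\<^sub>F x in nhds t. x \<in> {..<c}" by (intro eventually_nhds_in_open) auto
      then have "\<forall>\<^sub>F x in nhds t. (if x \<le> c then m else 0) = m" by (rule eventually_mono) auto
      from isCont_cong[OF this] show ?thesis by simp
    next
      case False
      then have "\<forall>\<^sub>F x in nhds t. x \<in> {c<..}" using elim by (intro eventually_nhds_in_open) auto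
      then have "\<forall>\<^sub>F x in nhds t. (if x \<le> c then m else 0) = 0" by (rule eventually_mono) auto
      from isCont_cong[OF this] show ?thesis by simp
    qed
  qed
  moreover have "(\<integral>\<^sup>+t. ennreal (norm (if t \<le> c then m else 0)) * indicator {0..} t \<partial>lborel) < \<infinity>"
  proof -
    have "(\<integral>\<^sup>+t. ennreal (norm (if t \<le> c then m else 0)) * indicator {0..} t \<partial>lborel) \<le>
      (\<integral>\<^sup>+t. ennreal (norm m) * indicator {0..c} t \<partial>lborel)"
      by (intro nn_integral_mono) (auto simp: indicator_def)
    also have "\<dots> < \<infinity>" by (simp add: nn_integral_cmult ennreal_mult_less_top emeasure_lborel_Icc_eq)
    finally show ?thesis .
  qed
  moreover have "(\<integral>\<^sup>+t. ennreal (norm (m - (if t \<le> c then m else 0))) * indicator {..0} t \<partial>lborel) < \<infinity>"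
  proof -
    have "(\<integral>\<^sup>+t. ennreal (norm (m - (if t \<le> c then m else 0))) * indicator {..0} t \<partial>lborel) \<le>
      (\<integral>\<^sup>+t. ennreal (norm m) * indicator {c..0} t \<partial>lborel)"
      by (intro nn_integral_mono) (auto simp: indicator_def)
    also have "\<dots> < \<infinity>" by (simp add: nn_integral_cmult ennreal_mult_less_top emeasure_lborel_Icc_eq)
    finally show ?thesis .
  qed
  ultimately show ?thesis by (simp add: survival_regular_def)
qed

text \<open>Continuity of \<open>F\<close> at \<open>u t\<close> squeezes \<open>H\<close> near \<open>t\<close>, since \<open>F (u r + d) \<le> H r \<le> F (u r)\<close>.\<close>

lemma isCont_squeeze_comp:
  fixes F H :: "real \<Rightarrow> 'e::ordered_banach"
  assumes lip: "\<And>s t. \<bar>u t - u s\<bar> \<le> \<bar>t - s\<bar>" and HF: "\<And>t. H t \<le> F (u t)"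
    and FH: "\<And>s t. u t < s \<Longrightarrow> F s \<le> H t" and cont: "isCont F (u t)"
  shows "isCont H t"
  unfolding continuous_at_eps_delta
proof (intro allI impI)
  fix e :: real assume "e > 0"
  then have "e / 6 > 0" by simp
  then obtain d where d: "d > 0" "\<And>r. dist r (u t) < d \<Longrightarrow> dist (F r) (F (u t)) < e / 6"
    using cont unfolding continuous_at_eps_delta by meson
  have close: "dist (H r) (F (u t)) < e / 2" if "dist r t < d / 2" for r
  proof -
    have r: "dist (u r) (u t) < d / 2" using lip[of r t] that by (simp add: dist_real_def)
    then have F1: "dist (F (u r)) (F (u t)) < e / 6" using d by simp
    have "dist (u r + d / 2) (u t) < d" using r d(1) unfolding dist_real_def by linarith
    then have F2: "dist (F (u r + d / 2)) (F (u t)) < e / 6" by (rule d)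
    have "norm (F (u r) - H r) \<le> norm (F (u r) - F (u r + d / 2))"
      using HF[of r] FH[of r "u r + d / 2"] d by (intro norm_diff_mono) auto
    also have "\<dots> \<le> dist (F (u r)) (F (u t)) + dist (F (u r + d / 2)) (F (u t))"
      unfolding dist_norm[symmetric] by (metis dist_commute dist_triangle)
    finally have "dist (H r) (F (u r)) < e / 3" using F1 F2 by (simp add: dist_norm norm_minus_commute)
    then show ?thesis using F1 dist_triangle[of "H r" "F (u t)" "F (u r)"] by linarith
  qed
  show "\<exists>d>0. \<forall>r. dist r t < d \<longrightarrow> dist (H r) (H t) < e"
  proof (intro exI[of _ "d / 2"] conjI allI impI)
    fix r assume "dist r t < d / 2"
    then show "dist (H r) (H t) < e"
      using close[of r] close[of t] d dist_triangle2[of "H r" "H t" "F (u t)"] by simp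
  qed (use d in simp)
qed

lemma survival_regular_add:
  fixes F G H :: "real \<Rightarrow> 'e::ordered_banach"
  assumes u: "mono u" and v: "mono v" and sum: "\<And>t. u t + v t = t"
    and F: "antimono F" "\<And>t. 0 \<le> F t" "\<And>t. F t \<le> m" and G: "antimono G" "\<And>t. 0 \<le> G t" "\<And>t. G t \<le> m"
    and H: "\<And>t. 0 \<le> H t" "\<And>t. H t \<le> m"
    and HF: "\<And>t. H t \<le> F (u t)" and FH: "\<And>s t. u t < s \<Longrightarrow> F s \<le> H t"
    and HG: "\<And>t. H t \<le> G (v t)" and GH: "\<And>s t. v t < s \<Longrightarrow> G s \<le> H t"
    and regF: "survival_regular m F" and regG: "survival_regular m G"
  shows "survival_regular m H"
proof -
  have sum': "v t + u t = t" for t using sum[of t] by simp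
  have "AE t in lborel. isCont F (u t) \<or> isCont G (v t)"
    using regF regG by (intro AE_complementary_mono[OF u v sum]) (auto simp: survival_regular_def)
  moreover have "isCont H t" if "isCont F (u t)" for t
    by (rule isCont_squeeze_comp[of u H F, OF complementary_mono_lipschitz[OF u v sum] HF FH that])
  moreover have "isCont H t" if "isCont G (v t)" for t
    by (rule isCont_squeeze_comp[of v H G, OF complementary_mono_lipschitz[OF v u sum'] HG GH that])
  ultimately have "AE t in lborel. isCont H t" by (auto elim!: eventually_mono)
  moreover have "(\<integral>\<^sup>+t. ennreal (norm (H t)) * indicator {0..} t \<partial>lborel) < \<infinity>"
  proof -
    note [measurable] = survival_regular_measurable[OF F] survival_regular_measurable[OF G]
    have "norm (H t) \<le> norm (F (t / 2)) + norm (G (t / 2))" for t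
    proof -
      \<comment> \<open>Two numbers with sum \<open>t\<close> cannot both lie below
        \<open>t / 2\<close>, so one of the decreasing functions dominates
        \<open>H t\<close>.\<close>
      have "t / 2 \<le> u t \<or> t / 2 \<le> v t" using sum[of t] by linarith
      then have "H t \<le> F (t / 2) \<or> H t \<le> G (t / 2)"
        using HF[of t] HG[of t] antimonoD[OF F(1), of "t / 2" "u t"] antimonoD[OF G(1), of "t / 2" "v t"]
        by (meson order_trans)
      then have "norm (H t) \<le> norm (F (t / 2)) \<or> norm (H t) \<le> norm (G (t / 2))"
        using H(1)[of t] norm_mono_cone by blast
      then show ?thesis using norm_ge_zero[of "F (t / 2)"] norm_ge_zero[of "G (t / 2)"] by linarith
    qed
    then have "(\<integral>\<^sup>+t. ennreal (norm (H t)) * indicator {0..} t \<partial>lborel) \<le>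
      (\<integral>\<^sup>+t. ennreal (norm (F (t / 2))) * indicator {0..} t + ennreal (norm (G (t / 2))) * indicator {0..} t \<partial>lborel)"
      by (intro nn_integral_mono) (auto simp: indicator_def simp flip: ennreal_plus)
    also have "\<dots> = (\<integral>\<^sup>+t. ennreal (norm (F (t / 2))) * indicator {0..} t \<partial>lborel) +
        (\<integral>\<^sup>+t. ennreal (norm (G (t / 2))) * indicator {0..} t \<partial>lborel)"
      by (rule nn_integral_add) measurable
    also have "\<dots> < \<infinity>"
      using survival_regular_scale[OF F regF, of 2] survival_regular_scale[OF G regG, of 2]
      by (simp add: survival_regular_def)
    finally show ?thesis .
  qed
  moreover have "(\<integral>\<^sup>+t. ennreal (norm (m - H t)) * indicator {..0} t \<partial>lborel) < \<infinity>"
  proof -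
    note [measurable] = survival_regular_measurable[OF F] survival_regular_measurable[OF G]
    have *: "norm (m - H t) \<le> norm (m - F (t / 4)) + norm (m - G (t / 4))" if "t < 0" for t
    proof -
      \<comment> \<open>For negative \<open>t\<close> one of the two numbers is at most
        \<open>t / 2\<close>, hence strictly below \<open>t / 4\<close>. The strictness is demanded
        by \<open>FH\<close> and \<open>GH\<close>; it can fail at 0, which is a null set.\<close>
      have "u t < t / 4 \<or> v t < t / 4" using sum[of t] that by linarith
      then have "m - H t \<le> m - F (t / 4) \<or> m - H t \<le> m - G (t / 4)"
        using FH[of t "t / 4"] GH[of t "t / 4"] by (auto intro: diff_left_mono)
      then have "norm (m - H t) \<le> norm (m - F (t / 4)) \<or> norm (m - H t) \<le> norm (m - G (t / 4))"
        using H(2)[of t] norm_mono_cone[of "m - H t"] by auto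
      then show ?thesis using norm_ge_zero[of "m - F (t / 4)"] norm_ge_zero[of "m - G (t / 4)"] by linarith
    qed
    have "AE t in lborel. t \<noteq> (0::real)" by (rule AE_lborel_singleton)
    then have "AE t in lborel. ennreal (norm (m - H t)) * indicator {..0} t \<le>
      ennreal (norm (m - F (t / 4))) * indicator {..0} t + ennreal (norm (m - G (t / 4))) * indicator {..0} t"
      by eventually_elim (use * in \<open>auto simp: indicator_def simp flip: ennreal_plus\<close>)
    then have "(\<integral>\<^sup>+t. ennreal (norm (m - H t)) * indicator {..0} t \<partial>lborel) \<le>
      (\<integral>\<^sup>+t. ennreal (norm (m - F (t / 4))) * indicator {..0} t + ennreal (norm (m - G (t / 4))) * indicator {..0} t \<partial>lborel)"
      by (rule nn_integral_mono_AE)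
    also have "\<dots> = (\<integral>\<^sup>+t. ennreal (norm (m - F (t / 4))) * indicator {..0} t \<partial>lborel) +
        (\<integral>\<^sup>+t. ennreal (norm (m - G (t / 4))) * indicator {..0} t \<partial>lborel)"
      by (rule nn_integral_add) measurable
    also have "\<dots> < \<infinity>"
      using survival_regular_scale[OF F regF, of 4] survival_regular_scale[OF G regG, of 4]
      by (simp add: survival_regular_def)
    finally show ?thesis .
  qed
  ultimately show ?thesis by (simp add: survival_regular_def)
qed

section \<open>The Choquet-Bochner integral\<close>

abbreviation level :: "('x set \<Rightarrow> 'e) \<Rightarrow> 'x set \<Rightarrow> ('x \<Rightarrow> real) \<Rightarrow> real \<Rightarrow> 'e" where
  "level \<mu> A f t \<equiv> \<mu> {x\<in>A. t \<le> f x}"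

locale vector_capacity_space =
  fixes X :: "'x set" and S :: "'x set set" and \<mu> :: "'x set \<Rightarrow> 'e::ordered_banach"
  assumes nonempty: "X \<noteq> {}" and lattice: "lattice_of_sets X S" and capacity: "vector_capacity S \<mu>"
begin

lemma subset_X: "A \<in> S \<Longrightarrow> A \<subseteq> X"
  using lattice by (auto simp: lattice_of_sets_def)

lemma capacity_mono: "A \<in> S \<Longrightarrow> B \<in> S \<Longrightarrow> A \<subseteq> B \<Longrightarrow> \<mu> A \<le> \<mu> B"
  using capacity by (simp add: vector_capacity_def)

lemma capacity_empty: "\<mu> {} = 0"
  using capacity by (simp add: vector_capacity_def)

lemma level_set_in:
  assumes "level_measurable X S f" "A \<in> S"
  shows "{x\<in>A. t \<le> f x} \<in> S"
proof -
  have "{x\<in>A. t \<le> f x} = A \<inter> {x\<in>X. t \<le> f x}" using subset_X[OF assms(2)] by auto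
  then show ?thesis using assms lattice by (simp add: level_measurable_def lattice_of_sets_def)
qed

lemma level_bounds:
  assumes "level_measurable X S f" "A \<in> S"
  shows "antimono (level \<mu> A f)" "0 \<le> level \<mu> A f t" "level \<mu> A f t \<le> \<mu> A"
proof -
  note l = level_set_in[OF assms]
  show "antimono (level \<mu> A f)" by (intro antimonoI capacity_mono l) auto
  show "0 \<le> level \<mu> A f t" using l capacity by (simp add: vector_capacity_def)
  show "level \<mu> A f t \<le> \<mu> A" by (intro capacity_mono l assms) auto
qed

lemma cb_integrable_iff:
  "cb_integrable X S \<mu> f \<longleftrightarrow>
    level_measurable X S f \<and> (\<forall>A\<in>S. survival_regular (\<mu> A) (level \<mu> A f))"
  unfolding cb_integrable_def
  using bochner_integrable_survival_iff[OF level_bounds(1)] by blast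

lemma cb_integral_survival:
  assumes "cb_integrable X S \<mu> f" "A \<in> S"
  shows "survival_integral (\<mu> A) (level \<mu> A f) (cb_integral \<mu> A f)"
  using assms unfolding cb_integrable_iff cb_integral_def
  by (intro survival_integral_bochner_integral level_bounds) auto

text \<open>From here on an integral is evaluated by exhibiting a survival integral of its level
  function; no Bochner integral has to be computed.\<close>

lemma cb_integral_eqI:
  assumes "cb_integrable X S \<mu> f" "A \<in> S" "survival_integral (\<mu> A) (level \<mu> A f) J"
  shows "cb_integral \<mu> A f = J"
  by (rule survival_integral_unique[OF cb_integral_survival[OF assms(1,2)] assms(3)])

lemma cb_integral_mono:
  assumes f: "cb_integrable X S \<mu> f" and g: "cb_integrable X S \<mu> g" and A: "A \<in> S"
    and le: "\<And>x. x \<in> X \<Longrightarrow> f x \<le> g x"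
  shows "cb_integral \<mu> A f \<le> cb_integral \<mu> A g"
proof (rule survival_integral_mono[OF cb_integral_survival[OF f A] cb_integral_survival[OF g A]])
  fix t show "level \<mu> A f t \<le> level \<mu> A g t"
  proof (rule capacity_mono)
    show "{x\<in>A. t \<le> f x} \<subseteq> {x\<in>A. t \<le> g x}"
      using le subset_X[OF A] by (auto intro: order_trans)
  qed (use f g A in \<open>auto simp: cb_integrable_iff intro!: level_set_in\<close>)
qed

lemma level_const: "level \<mu> A (\<lambda>x. c) = (\<lambda>t. if t \<le> c then \<mu> A else 0)"
  by (auto simp: capacity_empty)

lemma
  shows cb_integrable_const: "cb_integrable X S \<mu> (\<lambda>x. c)"
    and cb_integral_const: "A \<in> S \<Longrightarrow> cb_integral \<mu> A (\<lambda>x. c) = c *\<^sub>R \<mu> A"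
proof -
  have "{x\<in>X. t \<le> c} \<in> S" for t
    using lattice by (cases "t \<le> c") (auto simp: lattice_of_sets_def)
  then show *: "cb_integrable X S \<mu> (\<lambda>x. c)"
    unfolding cb_integrable_iff level_const by (simp add: level_measurable_def survival_regular_const)
  show "cb_integral \<mu> A (\<lambda>x. c) = c *\<^sub>R \<mu> A" if A: "A \<in> S"
  proof (rule cb_integral_eqI[OF * A])
    show "survival_integral (\<mu> A) (level \<mu> A (\<lambda>x. c)) (c *\<^sub>R \<mu> A)"
      unfolding level_const using capacity A
      by (intro survival_integral_const) (simp add: vector_capacity_def)
  qed
qed

lemma
  assumes f: "cb_integrable X S \<mu> f" and a: "0 \<le> a"
  shows cb_integrable_scale: "cb_integrable X S \<mu> (\<lambda>x. a * f x)"
    and cb_integral_scale: "A \<in> S \<Longrightarrow> cb_integral \<mu> A (\<lambda>x. a * f x) = a *\<^sub>R cb_integral \<mu> A f"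
proof -
  have "cb_integrable X S \<mu> (\<lambda>x. a * f x) \<and>
    (A \<in> S \<longrightarrow> cb_integral \<mu> A (\<lambda>x. a * f x) = a *\<^sub>R cb_integral \<mu> A f)" for A
  \<comment> \<open>The substitution \<open>t / a\<close> is meaningful only for positive
    \<open>a\<close>; for \<open>a = 0\<close> the product is the constant 0.\<close>
  proof (cases "a = 0")
    case True
    then show ?thesis using cb_integrable_const[of 0] cb_integral_const[of A 0] by simp
  next
    case False
    with a have a: "a > 0" by simp
    have le_iff: "t \<le> a * f x \<longleftrightarrow> t / a \<le> f x" for t x using a by (simp add: pos_divide_le_eq mult.commute)
    have m: "level_measurable X S f" using f by (simp add: cb_integrable_iff)
    then have "level_measurable X S (\<lambda>x. a * f x)"
      unfolding level_measurable_def le_iff by simp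
    moreover have "survival_regular (\<mu> A) (level \<mu> A (\<lambda>x. a * f x))" if "A \<in> S" for A
      unfolding le_iff
      by (rule survival_regular_scale[OF level_bounds[OF m that] _ a])
        (use f that in \<open>simp add: cb_integrable_iff\<close>)
    ultimately have int: "cb_integrable X S \<mu> (\<lambda>x. a * f x)" by (simp add: cb_integrable_iff)
    have "cb_integral \<mu> A (\<lambda>x. a * f x) = a *\<^sub>R cb_integral \<mu> A f" if A: "A \<in> S"
    proof (rule cb_integral_eqI[OF int A])
      show "survival_integral (\<mu> A) (level \<mu> A (\<lambda>x. a * f x)) (a *\<^sub>R cb_integral \<mu> A f)"
        unfolding le_iff by (rule survival_integral_scale[OF cb_integral_survival[OF f A] a])
    qed
    with int show ?thesis by blast
  qed
  then show "cb_integrable X S \<mu> (\<lambda>x. a * f x)"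
    "A \<in> S \<Longrightarrow> cb_integral \<mu> A (\<lambda>x. a * f x) = a *\<^sub>R cb_integral \<mu> A f" by blast+
qed

text \<open>A comonotonic pair factors through its sum: \<open>f = u (f + g)\<close> and \<open>g = v (f + g)\<close> with \<open>u, v\<close>
  monotone and \<open>u + v = id\<close>. Between and beyond the values of \<open>f + g\<close> the extension is not unique;
  the infimum is one explicit choice.\<close>

lemma comonotonic_decomposition:
  assumes co: "comonotonic X f g"
  obtains u v :: "real \<Rightarrow> real" where "mono u" "mono v" "\<And>t. u t + v t = t"
    "\<And>x t. x \<in> X \<Longrightarrow> t \<le> f x + g x \<Longrightarrow> u t \<le> f x"
    "\<And>x t. x \<in> X \<Longrightarrow> t \<le> f x + g x \<Longrightarrow> v t \<le> g x"
    "\<And>x t. x \<in> X \<Longrightarrow> f x + g x < t \<Longrightarrow> f x \<le> u t"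
    "\<And>x t. x \<in> X \<Longrightarrow> f x + g x < t \<Longrightarrow> g x \<le> v t"
proof -
  define u where "u t = (INF x\<in>X. max (f x) (t - g x))" for t
  \<comment> \<open>Each \<open>x\<close> forces \<open>u t\<close> into the interval with ends
    \<open>f x\<close> and \<open>t - g x\<close>, in whichever order they come. Comonotonicity says
    that every left end is at most every right end, so the infimum of the right ends lies in all the
    intervals.\<close>
  have cross: "min (f x) (t - g x) \<le> max (f y) (t - g y)" if "x \<in> X" "y \<in> X" for x y t
  proof (cases "f x \<le> f y")
    case False
    have "0 \<le> (f x - f y) * (g x - g y)" using co that by (simp add: comonotonic_def)
    then have "0 \<le> g x - g y" using False by (simp add: zero_le_mult_iff)
    then show ?thesis by simp
  qed auto
  have lower: "min (f x) (t - g x) \<le> u t" if "x \<in> X" for x t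
    unfolding u_def using cross that nonempty by (intro cINF_greatest) auto
  obtain x0 where x0: "x0 \<in> X" using nonempty by blast
  have upper: "u t \<le> max (f x) (t - g x)" if "x \<in> X" for x t
    unfolding u_def using cross[OF x0] that
    by (intro cINF_lower bdd_belowI2[of _ "min (f x0) (t - g x0)"]) auto
  have u_mono: "u s \<le> u t" if "s \<le> t" for s t
    unfolding u_def[of t]
  proof (intro cINF_greatest nonempty)
    fix x assume "x \<in> X"
    then show "u s \<le> max (f x) (t - g x)" using upper[of x s] that by auto
  qed
  have u_lip: "u t - (t - s) \<le> u s" if "s \<le> t" for s t
    unfolding u_def[of s]
  proof (intro cINF_greatest nonempty)
    fix x assume "x \<in> X"
    then show "u t - (t - s) \<le> max (f x) (s - g x)" using upper[of x t] that by auto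
  qed
  show ?thesis
  proof (rule that[of u "\<lambda>t. t - u t"])
    show "mono u" using u_mono by (rule monoI)
    show "mono (\<lambda>t. t - u t)" using u_lip by (intro monoI) (simp add: algebra_simps)
    fix x t assume x: "x \<in> X"
    show "u t \<le> f x" "t - u t \<le> g x" if "t \<le> f x + g x"
      using upper[OF x, of t] lower[OF x, of t] that by auto
    show "f x \<le> u t" "g x \<le> t - u t" if "f x + g x < t"
      using upper[OF x, of t] lower[OF x, of t] that by auto
  qed simp
qed

lemma
  assumes f: "cb_integrable X S \<mu> f" and g: "cb_integrable X S \<mu> g" and co: "comonotonic X f g"
  shows cb_integrable_add: "cb_integrable X S \<mu> (\<lambda>x. f x + g x)"
    and cb_integral_add: "A \<in> S \<Longrightarrow> cb_integral \<mu> A (\<lambda>x. f x + g x) = cb_integral \<mu> A f + cb_integral \<mu> A g"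
proof -
  obtain u v where uv: "mono u" "mono v" "\<And>t. u t + v t = t"
    and low: "\<And>x t. x \<in> X \<Longrightarrow> t \<le> f x + g x \<Longrightarrow> u t \<le> f x" "\<And>x t. x \<in> X \<Longrightarrow> t \<le> f x + g x \<Longrightarrow> v t \<le> g x"
    and up: "\<And>x t. x \<in> X \<Longrightarrow> f x + g x < t \<Longrightarrow> f x \<le> u t" "\<And>x t. x \<in> X \<Longrightarrow> f x + g x < t \<Longrightarrow> g x \<le> v t"
    by (rule comonotonic_decomposition[OF co]) (rule that)
  have mf: "level_measurable X S f" and mg: "level_measurable X S g"
    using f g by (simp_all add: cb_integrable_iff)
  have mh: "level_measurable X S (\<lambda>x. f x + g x)"
    unfolding level_measurable_def
  proof
    fix t
    \<comment> \<open>The two inequalities on the left add up to the one on the right, so a level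
      set of the sum is an intersection of level sets, and the lattice property makes the sum
      measurable.\<close>
    have "u t \<le> f x \<and> v t \<le> g x \<longleftrightarrow> t \<le> f x + g x" if "x \<in> X" for x
      using low[OF that, of t] uv(3)[of t] by auto
    then have "{x\<in>X. t \<le> f x + g x} = {x\<in>X. u t \<le> f x} \<inter> {x\<in>X. v t \<le> g x}" by auto
    then show "{x\<in>X. t \<le> f x + g x} \<in> S"
      using mf mg lattice by (simp add: level_measurable_def lattice_of_sets_def)
  qed
  \<comment> \<open>Stated for a generic pair (\<open>k\<close>, \<open>w\<close>), this serves
    (\<open>f\<close>, \<open>u\<close>) and (\<open>g\<close>, \<open>v\<close>) alike and delivers
    the sandwich and boundary hypotheses of the two addition lemmas.\<close>
  have between: "\<And>t. level \<mu> A (\<lambda>x. f x + g x) t \<le> level \<mu> A k (w t)"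
      "\<And>s t. w t < s \<Longrightarrow> level \<mu> A k s \<le> level \<mu> A (\<lambda>x. f x + g x) t"
      "\<And>s. (\<And>t. w t < s) \<Longrightarrow> level \<mu> A k s = 0"
      "\<And>s. (\<And>t. s < w t) \<Longrightarrow> level \<mu> A k s = \<mu> A"
    if A: "A \<in> S" and mk: "level_measurable X S k"
      and low: "\<forall>x\<in>X. \<forall>t\<le>f x + g x. w t \<le> k x"
      and up: "\<forall>x\<in>X. \<forall>t>f x + g x. k x \<le> w t" for A k and w :: "real \<Rightarrow> real"
  proof -
    note AX = subsetD[OF subset_X[OF A]]
    show "level \<mu> A (\<lambda>x. f x + g x) t \<le> level \<mu> A k (w t)" for t
      by (intro capacity_mono level_set_in A mh mk) (use low AX in auto)
    show "level \<mu> A k s \<le> level \<mu> A (\<lambda>x. f x + g x) t" if "w t < s" for s t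
    proof (intro capacity_mono level_set_in A mh mk subsetI)
      fix x assume x: "x \<in> {x\<in>A. s \<le> k x}"
      then have "\<not> f x + g x < t" using up AX[of x] that by force
      with x show "x \<in> {x\<in>A. t \<le> f x + g x}" by simp
    qed
    show "level \<mu> A k s = 0" if "\<And>t. w t < s" for s
    proof -
      \<comment> \<open>The bound \<open>up\<close> requires a strict inequality, so it is used at a
        point beyond \<open>f x + g x\<close>; the shift by 1 is arbitrary.\<close>
      have "k x < s" if "x \<in> A" for x
        using up[rule_format, OF AX[OF that], of "f x + g x + 1"] \<open>\<And>t. w t < s\<close>[of "f x + g x + 1"] by simp
      then have "{x\<in>A. s \<le> k x} = {}" by (auto simp: not_le)
      then show ?thesis by (simp only: capacity_empty)
    qed
    show "level \<mu> A k s = \<mu> A" if "\<And>t. s < w t" for s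
    proof -
      have "s \<le> k x" if "x \<in> A" for x
        using low[rule_format, OF AX[OF that], of "f x + g x"] \<open>\<And>t. s < w t\<close>[of "f x + g x"] by simp
      then have "{x\<in>A. s \<le> k x} = A" by auto
      then show ?thesis by simp
    qed
  qed
  have bf: "\<forall>x\<in>X. \<forall>t\<le>f x + g x. u t \<le> f x" "\<forall>x\<in>X. \<forall>t>f x + g x. f x \<le> u t"
    and bg: "\<forall>x\<in>X. \<forall>t\<le>f x + g x. v t \<le> g x" "\<forall>x\<in>X. \<forall>t>f x + g x. g x \<le> v t"
    using low up by blast+
  have "survival_regular (\<mu> A) (level \<mu> A (\<lambda>x. f x + g x))" if A: "A \<in> S" for A
  proof (rule survival_regular_add[of u v "level \<mu> A f" "\<mu> A" "level \<mu> A g",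
      OF uv level_bounds[OF mf A] level_bounds[OF mg A] level_bounds(2,3)[OF mh A]])
    show "survival_regular (\<mu> A) (level \<mu> A f)" "survival_regular (\<mu> A) (level \<mu> A g)"
      using f g A by (simp_all add: cb_integrable_iff)
  qed (fact between[OF A mf bf] between[OF A mg bg])+
  with mh show int: "cb_integrable X S \<mu> (\<lambda>x. f x + g x)" by (simp add: cb_integrable_iff)
  show "cb_integral \<mu> A (\<lambda>x. f x + g x) = cb_integral \<mu> A f + cb_integral \<mu> A g" if A: "A \<in> S"
  proof (rule cb_integral_eqI[OF int A], rule survival_integral_add[of u v "level \<mu> A f" "\<mu> A" "level \<mu> A g",
      OF uv level_bounds(2,3)[OF mf A] level_bounds(2,3)[OF mg A]])
    show "survival_integral (\<mu> A) (level \<mu> A f) (cb_integral \<mu> A f)"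
      "survival_integral (\<mu> A) (level \<mu> A g) (cb_integral \<mu> A g)"
      using cb_integral_survival f g A by blast+
  qed (fact between[OF A mf bf] between[OF A mg bg])+
qed

end

theorem lemma7:
  fixes X :: "'x set" and S :: "'x set set"
    and \<mu> :: "'x set \<Rightarrow> 'e::ordered_banach" and A :: "'x set"
  assumes "X \<noteq> {}" and "lattice_of_sets X S" and "vector_capacity S \<mu>" and "A \<in> S"
  shows
    "(\<forall>f. cb_integrable X S \<mu> f \<longrightarrow> (\<forall>x\<in>X. 0 \<le> f x) \<longrightarrow> 0 \<le> cb_integral \<mu> A f) \<and>
     (\<forall>f g. cb_integrable X S \<mu> f \<longrightarrow> cb_integrable X S \<mu> g \<longrightarrow> (\<forall>x\<in>X. f x \<le> g x) \<longrightarrow>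
        cb_integral \<mu> A f \<le> cb_integral \<mu> A g) \<and>
     (\<forall>f (a::real). cb_integrable X S \<mu> f \<longrightarrow> 0 \<le> a \<longrightarrow>
        cb_integrable X S \<mu> (\<lambda>x. a * f x) \<and>
        cb_integral \<mu> A (\<lambda>x. a * f x) = a *\<^sub>R cb_integral \<mu> A f) \<and>
     (cb_integrable X S \<mu> (\<lambda>x. 1) \<and> cb_integral \<mu> A (\<lambda>x. 1) = \<mu> A) \<and>
     (\<forall>f g. cb_integrable X S \<mu> f \<longrightarrow> cb_integrable X S \<mu> g \<longrightarrow> comonotonic X f g \<longrightarrow>
        cb_integrable X S \<mu> (\<lambda>x. f x + g x) \<and>
        cb_integral \<mu> A (\<lambda>x. f x + g x) = cb_integral \<mu> A f + cb_integral \<mu> A g) \<and>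
     (\<forall>f (c::real). cb_integrable X S \<mu> f \<longrightarrow>
        cb_integrable X S \<mu> (\<lambda>x. f x + c) \<and>
        cb_integral \<mu> A (\<lambda>x. f x + c) = cb_integral \<mu> A f + c *\<^sub>R \<mu> A)"
proof -
  interpret vector_capacity_space X S \<mu>
    using assms by unfold_locales
  note A = \<open>A \<in> S\<close>
  have pos: "0 \<le> cb_integral \<mu> A f" if "cb_integrable X S \<mu> f" "\<forall>x\<in>X. 0 \<le> f x" for f
    using cb_integral_mono[OF cb_integrable_const that(1) A, of 0] cb_integral_const[OF A, of 0] that(2) by simp
  \<comment> \<open>One factor of the product is 0, so translation invariance is additivity together
    with the integral of a constant.\<close>
  have const: "comonotonic X f (\<lambda>x. c)" for f :: "'x \<Rightarrow> real" and c
    by (simp add: comonotonic_def)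
  have translate: "cb_integrable X S \<mu> (\<lambda>x. f x + c)"
      "cb_integral \<mu> A (\<lambda>x. f x + c) = cb_integral \<mu> A f + c *\<^sub>R \<mu> A" if "cb_integrable X S \<mu> f" for f c
    using cb_integrable_add[OF that cb_integrable_const const] cb_integral_add[OF that cb_integrable_const const A]
      cb_integral_const[OF A] by simp_all
  have one: "cb_integral \<mu> A (\<lambda>x. 1) = \<mu> A"
    using cb_integral_const[OF A, of 1] by simp
  show ?thesis
  proof (intro conjI allI impI)
    show "cb_integral \<mu> A f \<le> cb_integral \<mu> A g"
      if "cb_integrable X S \<mu> f" "cb_integrable X S \<mu> g" "\<forall>x\<in>X. f x \<le> g x" for f g
      using that by (intro cb_integral_mono A) auto
  qed (fact pos one cb_integrable_const | rule translate, assumption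
    | rule cb_integrable_scale cb_integrable_add, assumption+
    | rule cb_integral_scale cb_integral_add, assumption+, rule A)+
qed

end
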